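(* Suppose $G$ is a finitely generated group containing no non-abelian free subgroup. Suppose $G$ can be written as an ascending HNN extension $\langle t,A : t^{-1}at=\phi(a)\text{ for all }a\in A\rangle$ (with $\phi:A\to A$ a monomorphism) and as non-trivial amalgamated products $C\ast_D E$ and $H\ast_K L$, where all component groups ($A,C,D,E,H,K,L$) are finitely generated. Then: 1) $D\cap A$ does not have finite index in $A$, and does not have finite index in $D$ (so neither $A$ nor $D$ is smaller than the other); 2) if $D\cap K$ has finite index in $K$ then $K=D$ (so neither $D$ nor $K$ is smaller than the other); 3) $C\ast_D E$ is a minimal splitting, and $\langle t,A : t^{-1}at=\phi(a)\text{ for all }a\in A\rangle$ is minimal if and only if $\phi(A)$ has finite index in $A$.
   Context: For subgroups $H,K$ of a group $G$, $H$ is smaller than $K$ if $H\cap K$ has finite index in $H$ and infinite index in $K$. A group $G$ splits non-trivially over a subgroup $H$ if $G$ is an HNN extension $A\ast_H$ or an amalgamated product $A\ast_H B$ with $A\neq H\neq B$ (a non-trivial amalgamated product). A splitting of $G$ over $H$ is minimal if $H$ is a minimal splitting subgroup of $G$: $G$ splits non-trivially over $H$ and no subgroup $K$ over which $G$ splits non-trivially is smaller than $H$. The ascending HNN extension above is regarded as a splitting of $G$ over $A$. All component groups are regarded as subgroups of $G$. *)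

theory Defs
  imports "HOL-Algebra.Coset" "HOL-Algebra.Generated_Groups"
begin

subsection \<open>Groups given by generators and relations\<close>

text \<open>A letter \<open>(x, True)\<close> stands for the generator \<open>x\<close> and \<open>(x, False)\<close> for its formal inverse.\<close>

type_synonym 'x word = "('x \<times> bool) list"

definition words_over :: "'x set \<Rightarrow> 'x word set" where
  "words_over X = lists (X \<times> UNIV)"

text \<open>The least congruence on the words over \<open>X\<close> that cancels inverse pairs and satisfies all
  relations \<open>u = v\<close> with \<open>(u, v) \<in> R\<close>.\<close>

inductive_set word_cong :: "'x set \<Rightarrow> ('x word \<times> 'x word) set \<Rightarrow> ('x word \<times> 'x word) set"
  for X :: "'x set" and R :: "('x word \<times> 'x word) set" where
  refl: "w \<in> words_over X \<Longrightarrow> (w, w) \<in> word_cong X R"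
| sym: "(u, v) \<in> word_cong X R \<Longrightarrow> (v, u) \<in> word_cong X R"
| trans: "(u, v) \<in> word_cong X R \<Longrightarrow> (v, w) \<in> word_cong X R \<Longrightarrow> (u, w) \<in> word_cong X R"
| append: "(u, v) \<in> word_cong X R \<Longrightarrow> (u', v') \<in> word_cong X R \<Longrightarrow> (u @ u', v @ v') \<in> word_cong X R"
| cancel: "x \<in> X \<Longrightarrow> ([(x, b), (x, \<not> b)], []) \<in> word_cong X R"
| relator: "(u, v) \<in> R \<Longrightarrow> u \<in> words_over X \<Longrightarrow> v \<in> words_over X \<Longrightarrow> (u, v) \<in> word_cong X R"

definition presented_group :: "'x set \<Rightarrow> ('x word \<times> 'x word) set \<Rightarrow> 'x word set monoid" where
  "presented_group X R =
    \<lparr>carrier = words_over X // word_cong X R,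
     mult = (\<lambda>P Q. \<Union>u\<in>P. \<Union>v\<in>Q. word_cong X R `` {u @ v}),
     one = word_cong X R `` {[]}\<rparr>"

lemma word_cong_words:
  "(u, v) \<in> word_cong X R \<Longrightarrow> u \<in> words_over X \<and> v \<in> words_over X"
  by (induction rule: word_cong.induct) (auto simp: words_over_def)

lemma equiv_word_cong: "equiv (words_over X) (word_cong X R)"
proof (rule equivI)
  show "word_cong X R \<subseteq> words_over X \<times> words_over X"
    by (auto dest: word_cong_words)
  show "refl_on (words_over X) (word_cong X R)"
    by (simp add: refl_on_def word_cong.refl)
  show "sym (word_cong X R)"
    by (rule symI) (rule word_cong.sym)
  show "trans (word_cong X R)"
    by (rule transI) (rule word_cong.trans)
qed

lemma presented_group_mult:
  assumes "u \<in> words_over X" and "v \<in> words_over X"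
  shows "word_cong X R `` {u} \<otimes>\<^bsub>presented_group X R\<^esub> word_cong X R `` {v} = word_cong X R `` {u @ v}"
proof -
  have c: "congruent2 (word_cong X R) (word_cong X R) (\<lambda>u v. word_cong X R `` {u @ v})"
    by (auto simp: congruent2_def intro!: equiv_class_eq[OF equiv_word_cong] word_cong.append)
  show ?thesis
    using UN_equiv_class2[OF equiv_word_cong equiv_word_cong c assms]
    by (simp add: presented_group_def)
qed

lemma word_cong_inverse:
  "w \<in> words_over X \<Longrightarrow> (rev (map (apsnd Not) w) @ w, []) \<in> word_cong X R"
proof (induction w)
  case Nil
  then show ?case by (simp add: word_cong.refl)
next
  case (Cons a w)
  obtain x b where a: "a = (x, b)" by force
  let ?v = "rev (map (apsnd Not) w)"
  have x: "x \<in> X" and w: "w \<in> words_over X"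
    using Cons.prems by (auto simp: a words_over_def)
  then have v: "?v \<in> words_over X"
    by (auto simp: words_over_def in_lists_conv_set)
  have "([(x, \<not> b), (x, b)], []) \<in> word_cong X R"
    using word_cong.cancel[OF x, of "\<not> b"] by simp
  from word_cong.append[OF word_cong.refl[OF v] word_cong.append[OF this word_cong.refl[OF w]]]
  have "(rev (map (apsnd Not) (a # w)) @ a # w, ?v @ w) \<in> word_cong X R"
    by (simp add: a)
  then show ?case using Cons.IH[OF w] word_cong.trans by blast
qed

lemma group_presented_group: "group (presented_group X R)"
proof (rule groupI)
  have car: "carrier (presented_group X R) = words_over X // word_cong X R"
    by (simp add: presented_group_def)
  have one: "\<one>\<^bsub>presented_group X R\<^esub> = word_cong X R `` {[]}"
    by (simp add: presented_group_def)
  have app: "u @ v \<in> words_over X" if "u \<in> words_over X" "v \<in> words_over X" for u v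
    using that by (simp add: words_over_def)
  have nil: "[] \<in> words_over X" by (simp add: words_over_def)
  show "\<one>\<^bsub>presented_group X R\<^esub> \<in> carrier (presented_group X R)"
    by (simp add: car one quotientI nil)
  fix P assume "P \<in> carrier (presented_group X R)"
  then obtain u where u: "u \<in> words_over X" "P = word_cong X R `` {u}"
    by (auto simp: car elim: quotientE)
  show "\<one>\<^bsub>presented_group X R\<^esub> \<otimes>\<^bsub>presented_group X R\<^esub> P = P"
    using presented_group_mult[OF nil u(1)] by (simp add: one u(2))
  have r: "rev (map (apsnd Not) u) \<in> words_over X"
    using u(1) by (auto simp: words_over_def in_lists_conv_set)
  have "word_cong X R `` {rev (map (apsnd Not) u)} \<otimes>\<^bsub>presented_group X R\<^esub> P
      = \<one>\<^bsub>presented_group X R\<^esub>"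
    using presented_group_mult[OF r u(1)]
      equiv_class_eq[OF equiv_word_cong word_cong_inverse[OF u(1)]]
    by (simp add: one u(2))
  then show "\<exists>Q\<in>carrier (presented_group X R). Q \<otimes>\<^bsub>presented_group X R\<^esub> P = \<one>\<^bsub>presented_group X R\<^esub>"
    using r by (auto simp: car intro: quotientI)
  fix Q assume "Q \<in> carrier (presented_group X R)"
  then obtain v where v: "v \<in> words_over X" "Q = word_cong X R `` {v}"
    by (auto simp: car elim: quotientE)
  show "P \<otimes>\<^bsub>presented_group X R\<^esub> Q \<in> carrier (presented_group X R)"
    by (simp add: car u v presented_group_mult app quotientI)
  fix S assume "S \<in> carrier (presented_group X R)"
  then obtain w where w: "w \<in> words_over X" "S = word_cong X R `` {w}"
    by (auto simp: car elim: quotientE)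
  show "P \<otimes>\<^bsub>presented_group X R\<^esub> Q \<otimes>\<^bsub>presented_group X R\<^esub> S =
      P \<otimes>\<^bsub>presented_group X R\<^esub> (Q \<otimes>\<^bsub>presented_group X R\<^esub> S)"
    by (simp add: u v w presented_group_mult app)
qed

text \<open>\<open>G = \<langle>X | R\<rangle>\<close>, where the generator \<open>x \<in> X\<close> is the element \<open>g x\<close> of \<open>G\<close>.\<close>

definition has_presentation ::
    "('a, 'm) monoid_scheme \<Rightarrow> 'x set \<Rightarrow> ('x word \<times> 'x word) set \<Rightarrow> ('x \<Rightarrow> 'a) \<Rightarrow> bool" where
  "has_presentation G X R g \<longleftrightarrow>
    (\<exists>h \<in> iso (presented_group X R) G. \<forall>x\<in>X. h (word_cong X R `` {[(x, True)]}) = g x)"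

subsection \<open>Free subgroups and finite generation\<close>

definition free_on :: "('a, 'm) monoid_scheme \<Rightarrow> 'a set \<Rightarrow> bool" where
  "free_on G S \<longleftrightarrow> S \<subseteq> carrier G \<and> has_presentation G S {} (\<lambda>x. x)"

definition contains_nonabelian_free_subgroup :: "('a, 'm) monoid_scheme \<Rightarrow> bool" where
  "contains_nonabelian_free_subgroup G \<longleftrightarrow>
    (\<exists>F. subgroup F G \<and> (\<exists>S. free_on (G\<lparr>carrier := F\<rparr>) S) \<and> \<not> comm_group (G\<lparr>carrier := F\<rparr>))"

definition finitely_generated :: "('a, 'm) monoid_scheme \<Rightarrow> 'a set \<Rightarrow> bool" where
  "finitely_generated G H \<longleftrightarrow> (\<exists>S. finite S \<and> S \<subseteq> carrier G \<and> H = generate G S)"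

subsection \<open>Amalgamated products and HNN extensions\<close>

text \<open>The multiplication table of a subgroup \<open>A\<close> of \<open>G\<close>, with \<open>a \<in> A\<close> written as the generator \<open>i a\<close>.\<close>

definition mult_table :: "('a, 'm) monoid_scheme \<Rightarrow> 'a set \<Rightarrow> ('a \<Rightarrow> 'x) \<Rightarrow> ('x word \<times> 'x word) set" where
  "mult_table G A i = {([(i a, True), (i b, True)], [(i (a \<otimes>\<^bsub>G\<^esub> b), True)]) | a b. a \<in> A \<and> b \<in> A}"

text \<open>\<open>G = A *\<^sub>H B\<close> for subgroups \<open>H \<subseteq> A, B\<close> of \<open>G\<close>: the natural map from the abstract amalgamated
  product to \<open>G\<close> is an isomorphism. The generators are the disjoint union of \<open>A\<close> and \<open>B\<close>.\<close>

definition amalgamated_product ::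
    "('a, 'm) monoid_scheme \<Rightarrow> 'a set \<Rightarrow> 'a set \<Rightarrow> 'a set \<Rightarrow> bool" where
  "amalgamated_product G A H B \<longleftrightarrow>
    subgroup A G \<and> subgroup B G \<and> subgroup H G \<and> H \<subseteq> A \<and> H \<subseteq> B \<and>
    has_presentation G (A <+> B)
      (mult_table G A Inl \<union> mult_table G B Inr \<union> {([(Inl h, True)], [(Inr h, True)]) | h. h \<in> H})
      (case_sum (\<lambda>a. a) (\<lambda>b. b))"

definition nontrivial_amalgamated_product ::
    "('a, 'm) monoid_scheme \<Rightarrow> 'a set \<Rightarrow> 'a set \<Rightarrow> 'a set \<Rightarrow> bool" where
  "nontrivial_amalgamated_product G A H B \<longleftrightarrow> amalgamated_product G A H B \<and> A \<noteq> H \<and> H \<noteq> B"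

text \<open>\<open>G = A *\<^sub>H = \<langle>t, A : t\<^sup>-\<^sup>1 h t = \<theta>(h) for all h \<in> H\<rangle>\<close> for a subgroup \<open>H\<close> of \<open>A\<close> and a
  monomorphism \<open>\<theta>\<close> from \<open>H\<close> into \<open>A\<close>. The generators are the stable letter \<open>None\<close> and \<open>Some a\<close> for
  \<open>a \<in> A\<close>.\<close>

definition hnn_extension ::
    "('a, 'm) monoid_scheme \<Rightarrow> 'a set \<Rightarrow> 'a set \<Rightarrow> ('a \<Rightarrow> 'a) \<Rightarrow> 'a \<Rightarrow> bool" where
  "hnn_extension G A H \<theta> t \<longleftrightarrow>
    subgroup A G \<and> subgroup H G \<and> H \<subseteq> A \<and> t \<in> carrier G \<and>
    \<theta> \<in> mon (G\<lparr>carrier := H\<rparr>) (G\<lparr>carrier := A\<rparr>) \<and>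
    has_presentation G (insert None (Some ` A))
      (mult_table G A Some \<union>
        {([(None, False), (Some h, True), (None, True)], [(Some (\<theta> h), True)]) | h. h \<in> H})
      (case_option t (\<lambda>a. a))"

abbreviation ascending_hnn_extension ::
    "('a, 'm) monoid_scheme \<Rightarrow> 'a set \<Rightarrow> ('a \<Rightarrow> 'a) \<Rightarrow> 'a \<Rightarrow> bool" where
  "ascending_hnn_extension G A \<phi> t \<equiv> hnn_extension G A A \<phi> t"

subsection \<open>Minimal splittings\<close>

definition finite_index_in :: "('a, 'm) monoid_scheme \<Rightarrow> 'a set \<Rightarrow> 'a set \<Rightarrow> bool" where
  "finite_index_in G H K \<longleftrightarrow> finite (rcosets\<^bsub>G\<lparr>carrier := K\<rparr>\<^esub> H)"

definition smaller_subgroup :: "('a, 'm) monoid_scheme \<Rightarrow> 'a set \<Rightarrow> 'a set \<Rightarrow> bool" where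
  "smaller_subgroup G H K \<longleftrightarrow> finite_index_in G (H \<inter> K) H \<and> \<not> finite_index_in G (H \<inter> K) K"

definition splits_over :: "('a, 'm) monoid_scheme \<Rightarrow> 'a set \<Rightarrow> bool" where
  "splits_over G H \<longleftrightarrow>
    (\<exists>A \<theta> t. hnn_extension G A H \<theta> t) \<or> (\<exists>A B. nontrivial_amalgamated_product G A H B)"

definition minimal_splitting_subgroup :: "('a, 'm) monoid_scheme \<Rightarrow> 'a set \<Rightarrow> bool" where
  "minimal_splitting_subgroup G H \<longleftrightarrow>
    splits_over G H \<and> \<not> (\<exists>K. splits_over G K \<and> smaller_subgroup G K H)"

end

theory Submission
  imports Defs "HOL-Algebra.Elementary_Groups" "HOL-Algebra.Group_Action"
begin

text \<open>Letting a splitting act on its normal forms, ping-pong produces a free subgroup of rank two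
  unless an amalgamated product \<open>C *\<^sub>D E\<close> has index two on both sides, so that \<open>D\<close> is the kernel of a
  surjection onto the infinite dihedral group, or an HNN extension is ascending, in one direction or
  the other. An ascending HNN extension with base \<open>K\<close> carries a homomorphism to the integers that
  kills \<open>K\<close>.

  The infinite dihedral group has no nontrivial finite normal subgroup, no infinite proper quotient
  and no nontrivial homomorphism to the integers, and it is not an ascending HNN extension of a finite
  group. This yields all the assertions about \<open>D\<close> and \<open>K\<close>. If \<open>\<phi> ` A\<close> has finite index in \<open>A\<close>, then
  \<open>G\<close> commensurates \<open>A\<close>; any ascending base \<open>L\<close> with \<open>L \<inter> A\<close> of finite index in \<open>L\<close> defines the same
  homomorphism to the integers up to sign, so the finitely generated group \<open>A\<close> lies in a conjugate of
  \<open>L\<close>, and \<open>L \<inter> A\<close> has finite index in \<open>A\<close>. If \<open>\<phi> ` A\<close> has infinite index, then it is itself a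
  smaller splitting subgroup.\<close>

section \<open>Words and presentations\<close>

text \<open>The factors and the base are subgroups of \<open>G\<close> by hypothesis, so a splitting
  says only that certain relations suffice. It is used as a universal property: an action or a
  homomorphism is prescribed on the factors and the relations are checked. Normal forms serve as a
  set on which \<open>G\<close> is made to act (van der Waerden's method); neither a tree nor
  uniqueness of normal forms for elements of \<open>G\<close> has to be established, because
  ping-pong only asks that every nonempty reduced word move one chosen point. Every splitting
  subgroup \<open>P\<close> is then either the kernel of a map onto the infinite dihedral group, or
  it satisfies \<open>inv s P s \<subseteq> P\<close> for some \<open>s\<close> generating
  \<open>G\<close> together with \<open>P\<close>. The comparisons share one mechanism: if finitely
  many cosets of \<open>Q\<close> cover \<open>P\<close>, a homomorphism killing \<open>Q\<close>
  has finite image on \<open>P\<close>. Finite generation of \<open>A\<close> matters because the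
  kernel of the homomorphism to the integers is only an increasing union of conjugates of
  \<open>L\<close>, and finitely many generators fit into one stage.\<close>

definition letter_val :: "('a, 'm) monoid_scheme \<Rightarrow> ('x \<Rightarrow> 'a) \<Rightarrow> 'x \<times> bool \<Rightarrow> 'a" where
  "letter_val G g l = (if snd l then g (fst l) else inv\<^bsub>G\<^esub> g (fst l))"

definition word_val :: "('a, 'm) monoid_scheme \<Rightarrow> ('x \<Rightarrow> 'a) \<Rightarrow> 'x word \<Rightarrow> 'a" where
  "word_val G g w = foldr (\<lambda>l r. letter_val G g l \<otimes>\<^bsub>G\<^esub> r) w \<one>\<^bsub>G\<^esub>"

lemma word_val_simps [simp]:
  "word_val G g [] = \<one>\<^bsub>G\<^esub>"
  "word_val G g (l # w) = letter_val G g l \<otimes>\<^bsub>G\<^esub> word_val G g w"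
  by (simp_all add: word_val_def)

lemma letter_val_simps [simp]:
  "letter_val G g (x, True) = g x" "letter_val G g (x, False) = inv\<^bsub>G\<^esub> g x"
  by (simp_all add: letter_val_def)

lemma words_over_simps [simp]:
  "[] \<in> words_over X"
  "l # w \<in> words_over X \<longleftrightarrow> fst l \<in> X \<and> w \<in> words_over X"
  "u @ v \<in> words_over X \<longleftrightarrow> u \<in> words_over X \<and> v \<in> words_over X"
  by (cases l; auto simp: words_over_def)+

lemma inverse_word_over: "w \<in> words_over X \<Longrightarrow> rev (map (apsnd Not) w) \<in> words_over X"
  by (auto simp: words_over_def in_lists_conv_set)

context group
begin

lemma letter_val_closed: "g \<in> X \<rightarrow> carrier G \<Longrightarrow> fst l \<in> X \<Longrightarrow> letter_val G g l \<in> carrier G"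
  by (auto simp: letter_val_def)

lemma word_val_closed: "g \<in> X \<rightarrow> carrier G \<Longrightarrow> w \<in> words_over X \<Longrightarrow> word_val G g w \<in> carrier G"
  by (induction w) (auto intro: letter_val_closed)

lemma word_val_append:
  "g \<in> X \<rightarrow> carrier G \<Longrightarrow> u \<in> words_over X \<Longrightarrow> v \<in> words_over X \<Longrightarrow>
    word_val G g (u @ v) = word_val G g u \<otimes> word_val G g v"
  by (induction u) (auto simp: m_assoc word_val_closed letter_val_closed)

lemma word_cong_word_val:
  assumes "g \<in> X \<rightarrow> carrier G"
    and "\<And>u v. (u, v) \<in> R \<Longrightarrow> u \<in> words_over X \<Longrightarrow> v \<in> words_over X \<Longrightarrow> word_val G g u = word_val G g v"
    and "(u, v) \<in> word_cong X R"
  shows "word_val G g u = word_val G g v"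
  using assms(3)
proof induction
  case (append u v u' v')
  then show ?case
    by (metis word_val_append[OF assms(1)] word_cong_words)
next
  case (cancel x b)
  then show ?case using assms(1)
    by (cases b) (auto simp: Pi_iff)
qed (auto simp: assms(2))

lemma word_val_inverse:
  assumes "g \<in> X \<rightarrow> carrier G" "w \<in> words_over X"
  shows "word_val G g (rev (map (apsnd Not) w)) = inv (word_val G g w)"
proof -
  have "word_val G g (rev (map (apsnd Not) w)) \<otimes> word_val G g w = \<one>"
    using word_cong_word_val[OF assms(1) _ word_cong_inverse[OF assms(2), of "{}"]]
    by (simp add: word_val_append[OF assms(1) inverse_word_over assms(2)] assms(2))
  then show ?thesis
    by (metis inv_equality inverse_word_over word_val_closed assms)
qed

lemma word_val_generate:
  assumes "g \<in> X \<rightarrow> carrier G" "w \<in> words_over X"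
  shows "word_val G g w \<in> generate G (g ` X)"
  using assms(2)
proof (induction w)
  case (Cons l w)
  then have "letter_val G g l \<in> generate G (g ` X)"
    by (cases l) (auto simp: letter_val_def intro: generate.intros)
  then show ?case using Cons by (auto intro: generate.eng)
qed (auto intro: generate.one)

lemma generate_imp_word_val:
  assumes "g \<in> X \<rightarrow> carrier G" "y \<in> generate G (g ` X)"
  shows "\<exists>w\<in>words_over X. word_val G g w = y"
  using assms(2)
proof induction
  case (incl h)
  then obtain x where "x \<in> X" "h = g x" by auto
  then show ?case using assms(1) by (intro bexI[of _ "[(x, True)]"]) (auto simp: Pi_iff)
next
  case (inv h)
  then obtain x where "x \<in> X" "h = g x" by auto
  then show ?case using assms(1) by (intro bexI[of _ "[(x, False)]"]) (auto simp: Pi_iff)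
next
  case (eng a b)
  then obtain u v where "u \<in> words_over X" "v \<in> words_over X" "word_val G g u = a" "word_val G g v = b"
    by auto
  then show ?case by (intro bexI[of _ "u @ v"]) (auto simp: word_val_append[OF assms(1)])
qed (auto intro: bexI[of _ "[]"])

lemma presentation_word_val:
  assumes h: "h \<in> iso (presented_group X R) G"
    and hx: "\<And>x. x \<in> X \<Longrightarrow> h (word_cong X R `` {[(x, True)]}) = g x"
    and w: "w \<in> words_over X"
  shows "h (word_cong X R `` {w}) = word_val G g w"
proof -
  let ?P = "presented_group X R"
  interpret P: group ?P by (rule group_presented_group)
  have hom: "h \<in> hom ?P G" using h by (simp add: iso_def)
  interpret h: group_hom ?P G h by unfold_locales (rule hom)
  have car: "word_cong X R `` {w} \<in> carrier ?P" if "w \<in> words_over X" for w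
    using that by (simp add: presented_group_def quotientI)
  have one: "\<one>\<^bsub>?P\<^esub> = word_cong X R `` {[]}" by (simp add: presented_group_def)
  have letter: "h (word_cong X R `` {[l]}) = letter_val G g l" if "fst l \<in> X" for l
  proof (cases l)
    case (Pair x b)
    have x: "x \<in> X" using that Pair by simp
    show ?thesis
    proof (cases b)
      case False
      have "word_cong X R `` {[(x, False)]} \<otimes>\<^bsub>?P\<^esub> word_cong X R `` {[(x, True)]} = \<one>\<^bsub>?P\<^esub>"
        using word_cong.cancel[OF x, of False R] x
        by (simp add: one presented_group_mult equiv_class_eq[OF equiv_word_cong])
      then have "word_cong X R `` {[(x, False)]} = inv\<^bsub>?P\<^esub> (word_cong X R `` {[(x, True)]})"
        using x by (intro P.inv_equality[symmetric]) (auto simp: car)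
      then show ?thesis using x False Pair by (simp add: car hx)
    qed (use Pair x hx in auto)
  qed
  show ?thesis using w
  proof (induction w)
    case Nil
    then show ?case using h.hom_one by (simp add: one)
  next
    case (Cons l w)
    have "word_cong X R `` {l # w} = word_cong X R `` {[l]} \<otimes>\<^bsub>?P\<^esub> word_cong X R `` {w}"
      using Cons.prems presented_group_mult[of "[l]" X w R] by simp
    then show ?case using Cons by (simp add: car letter)
  qed
qed

text \<open>The definition asks for an isomorphism from a set of word classes; generation, together
  with agreement of the congruence with equality of values, is easier to check and to use. Classes
  do not appear again afterwards.\<close>

lemma has_presentation_iff:
  "has_presentation G X R g \<longleftrightarrow> g \<in> X \<rightarrow> carrier G \<and> generate G (g ` X) = carrier G \<and>
    (\<forall>u\<in>words_over X. \<forall>v\<in>words_over X. word_val G g u = word_val G g v \<longleftrightarrow> (u, v) \<in> word_cong X R)"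
  (is "_ \<longleftrightarrow> ?gen")
proof
  let ?P = "presented_group X R"
  have car: "word_cong X R `` {w} \<in> carrier ?P" if "w \<in> words_over X" for w
    using that by (simp add: presented_group_def quotientI)
  assume "has_presentation G X R g"
  then obtain h where h: "h \<in> iso (presented_group X R) G"
    and hx: "\<And>x. x \<in> X \<Longrightarrow> h (word_cong X R `` {[(x, True)]}) = g x"
    by (auto simp: has_presentation_def)
  note hw = presentation_word_val[OF h hx]
  have hc: "h x \<in> carrier G" if "x \<in> carrier ?P" for x
    using h that by (auto simp: iso_def hom_def)
  have g: "g \<in> X \<rightarrow> carrier G"
    using hc[OF car] by (fastforce simp flip: hx)
  have "x \<in> generate G (g ` X)" if "x \<in> carrier G" for x
  proof -
    have "x \<in> h ` carrier ?P" using h that by (simp add: iso_def bij_betw_def)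
    then obtain q where "q \<in> carrier ?P" "h q = x" by auto
    then obtain w where "w \<in> words_over X" "h (word_cong X R `` {w}) = x"
      by (auto simp: presented_group_def elim!: quotientE)
    then show ?thesis using word_val_generate[OF g] hw by metis
  qed
  then have gen: "generate G (g ` X) = carrier G"
    using g generate_incl[of "g ` X"] by blast
  have "word_val G g u = word_val G g v \<longleftrightarrow> (u, v) \<in> word_cong X R"
    if uv: "u \<in> words_over X" "v \<in> words_over X" for u v
  proof -
    have "inj_on h (carrier ?P)" using h by (auto simp: iso_def bij_betw_def)
    then have "word_val G g u = word_val G g v \<longleftrightarrow> word_cong X R `` {u} = word_cong X R `` {v}"
      using hw uv car by (metis inj_onD)
    then show ?thesis using eq_equiv_class_iff[OF equiv_word_cong uv] by metis
  qed
  then show ?gen using g gen by blast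
next
  let ?P = "presented_group X R"
  assume ?gen
  then have g: "g \<in> X \<rightarrow> carrier G" and gen: "generate G (g ` X) = carrier G"
    and eq: "\<And>u v. u \<in> words_over X \<Longrightarrow> v \<in> words_over X \<Longrightarrow>
      word_val G g u = word_val G g v \<longleftrightarrow> (u, v) \<in> word_cong X R" by auto
  \<comment> \<open>Any word of the class will do: congruent words have equal values.\<close>
  define h where "h P = word_val G g (SOME w. w \<in> P)" for P
  have hw: "h (word_cong X R `` {w}) = word_val G g w" if "w \<in> words_over X" for w
  proof -
    have "w \<in> word_cong X R `` {w}" using that by (auto intro: word_cong.refl)
    then have "(SOME w'. w' \<in> word_cong X R `` {w}) \<in> word_cong X R `` {w}" by (rule someI)
    then show ?thesis using eq[OF that] word_cong_words by (fastforce simp: h_def)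
  qed
  have ex: "\<exists>w\<in>words_over X. q = word_cong X R `` {w}" if "q \<in> carrier ?P" for q
    using that by (auto simp: presented_group_def elim: quotientE)
  have "h \<in> hom ?P G"
  proof (rule homI)
    fix q assume "q \<in> carrier ?P"
    then obtain u where u: "u \<in> words_over X" "q = word_cong X R `` {u}" using ex by auto
    show "h q \<in> carrier G" using u g by (simp add: hw word_val_closed)
    fix r assume "r \<in> carrier ?P"
    then obtain v where v: "v \<in> words_over X" "r = word_cong X R `` {v}" using ex by auto
    show "h (q \<otimes>\<^bsub>?P\<^esub> r) = h q \<otimes> h r"
      using u v g by (simp add: presented_group_mult hw word_val_append)
  qed
  moreover have "inj_on h (carrier ?P)"
  proof (rule inj_onI)
    fix q r assume "q \<in> carrier ?P" "r \<in> carrier ?P" and h: "h q = h r"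
    then obtain u v where uv: "u \<in> words_over X" "q = word_cong X R `` {u}"
      "v \<in> words_over X" "r = word_cong X R `` {v}" using ex by meson
    then have "(u, v) \<in> word_cong X R" using h eq by (simp add: hw)
    then show "q = r" using uv equiv_class_eq[OF equiv_word_cong] by blast
  qed
  moreover have "h ` carrier ?P = carrier G"
  proof
    show "h ` carrier ?P \<subseteq> carrier G" using \<open>h \<in> hom ?P G\<close> by (auto simp: hom_def)
    show "carrier G \<subseteq> h ` carrier ?P"
    proof
      fix x assume "x \<in> carrier G"
      then obtain w where "w \<in> words_over X" "word_val G g w = x"
        using generate_imp_word_val[OF g] gen by auto
      then show "x \<in> h ` carrier ?P"
        using hw[of w] by (auto simp: presented_group_def intro!: image_eqI quotientI)
    qed
  qed
  ultimately have "h \<in> iso ?P G" by (simp add: iso_def bij_betw_def)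
  moreover have "h (word_cong X R `` {[(x, True)]}) = g x" if "x \<in> X" for x
    using that g by (simp add: hw Pi_iff)
  ultimately show "has_presentation G X R g" by (auto simp: has_presentation_def)
qed

lemma presentation_relation:
  assumes "has_presentation G X R g" "(u, v) \<in> R" "u \<in> words_over X" "v \<in> words_over X"
  shows "word_val G g u = word_val G g v"
  using assms word_cong.relator by (fastforce simp: has_presentation_iff)

text \<open>Von Dyck's theorem. An element is spelled by an arbitrary word and the spelling is
  evaluated in \<open>M\<close>; two spellings are congruent, and the congruence is respected in
  \<open>M\<close> because its relators are.\<close>

lemma presentation_hom:
  assumes pres: "has_presentation G X R g" and M: "group M" and f: "f \<in> X \<rightarrow> carrier M"
    and rel: "\<And>u v. (u, v) \<in> R \<Longrightarrow> u \<in> words_over X \<Longrightarrow> v \<in> words_over X \<Longrightarrow>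
      word_val M f u = word_val M f v"
  shows "\<exists>\<rho>\<in>hom G M. \<forall>x\<in>X. \<rho> (g x) = f x"
proof -
  interpret M: group M by (rule M)
  have g: "g \<in> X \<rightarrow> carrier G" and gen: "generate G (g ` X) = carrier G"
    and eq: "\<And>u v. u \<in> words_over X \<Longrightarrow> v \<in> words_over X \<Longrightarrow>
      word_val G g u = word_val G g v \<Longrightarrow> (u, v) \<in> word_cong X R"
    using pres by (auto simp: has_presentation_iff)
  define \<rho> where "\<rho> y = word_val M f (SOME w. w \<in> words_over X \<and> word_val G g w = y)" for y
  have \<rho>: "\<rho> (word_val G g w) = word_val M f w" if "w \<in> words_over X" for w
  proof -
    let ?w = "SOME w'. w' \<in> words_over X \<and> word_val G g w' = word_val G g w"
    have "?w \<in> words_over X \<and> word_val G g ?w = word_val G g w"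
      by (rule someI) (use that in simp)
    then have "(?w, w) \<in> word_cong X R" using that eq by blast
    then show ?thesis unfolding \<rho>_def using M.word_cong_word_val[OF f rel] by blast
  qed
  have "\<rho> \<in> hom G M"
  proof (rule homI)
    fix y assume "y \<in> carrier G"
    then obtain u where u: "u \<in> words_over X" "word_val G g u = y"
      using generate_imp_word_val[OF g] gen by auto
    show "\<rho> y \<in> carrier M" using \<rho> u M.word_val_closed[OF f] by auto
    fix z assume "z \<in> carrier G"
    then obtain v where v: "v \<in> words_over X" "word_val G g v = z"
      using generate_imp_word_val[OF g] gen by auto
    show "\<rho> (y \<otimes> z) = \<rho> y \<otimes>\<^bsub>M\<^esub> \<rho> z"
      using \<rho>[of "u @ v"] \<rho>[of u] \<rho>[of v] u v
      by (simp add: word_val_append[OF g] M.word_val_append[OF f])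
  qed
  moreover have "\<rho> (g x) = f x" if "x \<in> X" for x
    using \<rho>[of "[(x, True)]"] that g f by (auto simp: Pi_iff)
  ultimately show ?thesis by blast
qed

lemma presentation_generate:
  assumes "has_presentation G X R g"
  shows "generate G (g ` X) = carrier G" "g \<in> X \<rightarrow> carrier G"
  using assms by (auto simp: has_presentation_iff)

text \<open>Products are peeled from the left, one generator or inverse generator at a time, which
  is how the normal forms below are built up.\<close>

lemma generate_induct_left [consumes 2, case_names one mult]:
  assumes S: "S \<subseteq> carrier G" and x: "x \<in> generate G S"
    and one: "P \<one>"
    and step: "\<And>s y. s \<in> S \<Longrightarrow> y \<in> carrier G \<Longrightarrow> P y \<Longrightarrow> P (s \<otimes> y) \<and> P (inv s \<otimes> y)"
  shows "P x"
proof -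
  have car: "generate G S \<subseteq> carrier G" by (rule generate_incl[OF S])
  \<comment> \<open>Strengthened to left multiplication by \<open>x\<close>, the claim makes the
    case of a product a mere composition.\<close>
  have "P (x \<otimes> y)" if "P y" "y \<in> carrier G" for y
    using x that
  proof (induction arbitrary: y)
    case (eng a b)
    then have "a \<in> carrier G" "b \<in> carrier G" using car by auto
    then show ?case using eng by (simp add: m_assoc)
  qed (use step S in auto)
  from this[OF one] show ?thesis using x car by auto
qed

end

section \<open>Free subgroups from ping-pong\<close>

definition reduced :: "'x word \<Rightarrow> bool" where
  "reduced w \<longleftrightarrow> successively (\<lambda>l m. m \<noteq> (fst l, \<not> snd l)) w"

text \<open>Only existence is proved here; that nonempty reduced words are nontrivial will come from
  ping-pong.\<close>

lemma ex_reduced_word: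
  "w \<in> words_over X \<Longrightarrow> \<exists>w'. (w, w') \<in> word_cong X R \<and> reduced w'"
proof (induction w)
  case Nil
  then show ?case by (intro exI[of _ "[]"]) (auto simp: reduced_def intro: word_cong.refl)
next
  case (Cons l w)
  then obtain w' where w': "(w, w') \<in> word_cong X R" "reduced w'" by auto
  have "[l] \<in> words_over X" using Cons.prems by simp
  then have lw: "(l # w, l # w') \<in> word_cong X R"
    using word_cong.append[OF word_cong.refl w'(1)] by fastforce
  show ?case
  proof (cases "w' \<noteq> [] \<and> hd w' = (fst l, \<not> snd l)")
    case True
    then obtain v where v: "w' = (fst l, \<not> snd l) # v" by (cases w') auto
    have "v \<in> words_over X" "fst l \<in> X"
      using word_cong_words[OF w'(1)] v Cons.prems by auto
    then have "([(fst l, snd l), (fst l, \<not> snd l)] @ v, [] @ v) \<in> word_cong X R"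
      by (intro word_cong.append word_cong.cancel word_cong.refl)
    then have "(l # w', v) \<in> word_cong X R" by (simp add: v)
    then have "(l # w, v) \<in> word_cong X R" using lw word_cong.trans by blast
    then show ?thesis using w'(2) v by (auto simp: reduced_def successively_Cons)
  next
    case False
    then show ?thesis using lw w'(2) by (auto simp: reduced_def successively_Cons)
  qed
qed

context group
begin

text \<open>If \<open>u\<close> and \<open>v\<close> have equal values, \<open>u\<close> followed by
  the inverse of \<open>v\<close> is congruent to a reduced word of value one, hence to the empty
  word; appending \<open>v\<close> then gives the congruence of \<open>u\<close> and
  \<open>v\<close>.\<close>

lemma free_on_generate:
  assumes S: "S \<subseteq> carrier G"
    and red: "\<And>w. w \<in> words_over S \<Longrightarrow> reduced w \<Longrightarrow> word_val G (\<lambda>x. x) w = \<one> \<Longrightarrow> w = []"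
  shows "free_on (G\<lparr>carrier := generate G S\<rparr>) S"
proof -
  let ?F = "G\<lparr>carrier := generate G S\<rparr>"
  have sub: "subgroup (generate G S) G" by (rule generate_is_subgroup[OF S])
  interpret F: group ?F by (rule subgroup_imp_group[OF sub])
  have SF: "S \<subseteq> generate G S" by (auto intro: generate.incl)
  have val: "word_val ?F (\<lambda>x. x) w = word_val G (\<lambda>x. x) w" if "w \<in> words_over S" for w
    using that
  proof (induction w)
    case (Cons l w)
    then have "fst l \<in> generate G S" using SF by auto
    then show ?case using Cons m_inv_consistent[OF sub] by (auto simp: letter_val_def)
  qed simp
  have g: "(\<lambda>x. x) \<in> S \<rightarrow> carrier G" using S by auto
  have eq: "word_val G (\<lambda>x. x) u = word_val G (\<lambda>x. x) v \<longleftrightarrow> (u, v) \<in> word_cong S {}"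
    if uv: "u \<in> words_over S" "v \<in> words_over S" for u v
  proof
    assume uv': "word_val G (\<lambda>x. x) u = word_val G (\<lambda>x. x) v"
    let ?v = "rev (map (apsnd Not) v)"
    have v: "?v \<in> words_over S" by (rule inverse_word_over[OF uv(2)])
    obtain w where w: "(u @ ?v, w) \<in> word_cong S {}" "reduced w"
      using ex_reduced_word[of "u @ ?v" S "{}"] uv v by auto
    have "word_val G (\<lambda>x. x) w = word_val G (\<lambda>x. x) (u @ ?v)"
      using word_cong_word_val[OF g _ w(1)] by auto
    also have "\<dots> = \<one>"
      using uv v uv' word_val_closed[OF g uv(2)]
      by (simp add: word_val_append[OF g] word_val_inverse[OF g])
    finally have "w = []" using red w word_cong_words[OF w(1)] by blast
    then have 1: "((u @ ?v) @ v, [] @ v) \<in> word_cong S {}"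
      using w uv by (intro word_cong.append word_cong.refl) auto
    have 2: "(u @ (?v @ v), u @ []) \<in> word_cong S {}"
      using uv by (intro word_cong.append word_cong.refl word_cong_inverse)
    show "(u, v) \<in> word_cong S {}"
      using 1 2 word_cong.sym word_cong.trans by fastforce
  next
    assume "(u, v) \<in> word_cong S {}"
    then show "word_val G (\<lambda>x. x) u = word_val G (\<lambda>x. x) v"
      using word_cong_word_val[OF g] by blast
  qed
  have "generate ?F ((\<lambda>x. x) ` S) = carrier ?F"
    using generate_consistent[OF SF sub] by simp
  then show ?thesis
    using SF eq val by (auto simp: free_on_def F.has_presentation_iff)
qed

lemma ping_pong:
  assumes act: "group_action G \<Omega> \<rho>" and ab: "a \<in> carrier G" "b \<in> carrier G" and p: "p \<in> \<Omega>"
    and a: "\<And>z. z \<in> \<Omega> \<Longrightarrow> z \<notin> A' \<Longrightarrow> \<rho> a z \<in> A"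
    and a': "\<And>z. z \<in> \<Omega> \<Longrightarrow> z \<notin> A \<Longrightarrow> \<rho> (inv a) z \<in> A'"
    and b: "\<And>z. z \<in> \<Omega> \<Longrightarrow> z \<notin> B' \<Longrightarrow> \<rho> b z \<in> B"
    and b': "\<And>z. z \<in> \<Omega> \<Longrightarrow> z \<notin> B \<Longrightarrow> \<rho> (inv b) z \<in> B'"
    and disj: "A \<inter> A' = {}" "B \<inter> B' = {}" "(A \<union> A') \<inter> (B \<union> B') = {}"
    and notin: "p \<notin> A \<union> A' \<union> B \<union> B'"
  shows "contains_nonabelian_free_subgroup G"
proof -
  interpret act: group_action G \<Omega> \<rho> by (rule act)
  have "\<rho> a p \<in> A" "\<rho> b p \<in> B" using a b p notin by auto
  then have neq: "a \<noteq> b" using disj by auto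
  \<comment> \<open>The letter \<open>l\<close> throws everything outside the set of its inverse
    letter into \<open>U l\<close>. In a reduced word no letter is ever applied inside its
    exceptional set, so the image of \<open>p\<close> is governed by the first letter.\<close>
  define U where "U l = (if fst l = a then if snd l then A else A' else if snd l then B else B')" for l
  have pU: "p \<notin> U l" for l using notin by (auto simp: U_def)
  have disjU: "U l \<inter> U m = {}" if "fst l \<in> {a, b}" "fst m \<in> {a, b}" "l \<noteq> m" for l m
    using that disj by (cases l; cases m) (auto simp: U_def)
  have step: "\<rho> (letter_val G (\<lambda>x. x) l) z \<in> U l"
    if "fst l \<in> {a, b}" "z \<in> \<Omega>" "z \<notin> U (fst l, \<not> snd l)" for l z
    using that a a' b b' neq by (cases l) (auto simp: U_def letter_val_def split: if_splits)
  have S: "{a, b} \<subseteq> carrier G" using ab by auto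
  then have g: "(\<lambda>x. x) \<in> {a, b} \<rightarrow> carrier G" by auto
  have "\<rho> \<one> p = p" using act.id_eq_one p by (metis restrict_apply')
  moreover have hd: "\<rho> (word_val G (\<lambda>x. x) w) p \<in> U (hd w)"
    if "w \<in> words_over {a, b}" "reduced w" "w \<noteq> []" for w
    using that
  proof (induction w)
    case (Cons l w)
    let ?z = "\<rho> (word_val G (\<lambda>x. x) w) p"
    have w: "w \<in> words_over {a, b}" and l: "fst l \<in> {a, b}" using Cons.prems by auto
    have "?z \<notin> U (fst l, \<not> snd l)"
    proof (cases "w = []")
      case True
      then show ?thesis using \<open>\<rho> \<one> p = p\<close> pU by simp
    next
      case False
      then have "?z \<in> U (hd w)" "hd w \<noteq> (fst l, \<not> snd l)" "fst (hd w) \<in> {a, b}"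
        using Cons by (auto simp: reduced_def successively_Cons neq_Nil_conv)
      then show ?thesis using disjU[of "hd w" "(fst l, \<not> snd l)"] l by auto
    qed
    moreover have "?z \<in> \<Omega>" using act.element_image word_val_closed[OF g w] p by blast
    moreover have "\<rho> (word_val G (\<lambda>x. x) (l # w)) p = \<rho> (letter_val G (\<lambda>x. x) l) ?z"
      using act.composition_rule[OF p letter_val_closed[OF g l] word_val_closed[OF g w]] by simp
    ultimately show ?case using step[OF l] by simp
  qed simp
  ultimately have red: "w = []"
    if "w \<in> words_over {a, b}" "reduced w" "word_val G (\<lambda>x. x) w = \<one>" for w
    using that pU by metis
  let ?F = "G\<lparr>carrier := generate G {a, b}\<rparr>"
  have sub: "subgroup (generate G {a, b}) G" by (rule generate_is_subgroup[OF S])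
  \<comment> \<open>The commutator is a nonempty reduced word, so its value is not one.\<close>
  have "a \<otimes> b \<noteq> b \<otimes> a"
  proof
    assume eq: "a \<otimes> b = b \<otimes> a"
    have "a \<otimes> (b \<otimes> (inv a \<otimes> inv b)) = (a \<otimes> b) \<otimes> inv (b \<otimes> a)"
      using ab by (simp add: inv_mult_group m_assoc)
    also have "\<dots> = \<one>" using ab unfolding eq by (intro r_inv) simp
    finally have "word_val G (\<lambda>x. x) [(a, True), (b, True), (a, False), (b, False)] = \<one>"
      using ab by simp
    then show False
      using red[of "[(a, True), (b, True), (a, False), (b, False)]"] neq by (simp add: reduced_def)
  qed
  then have "\<not> comm_group ?F"
    using comm_groupE(4)[of ?F a b] by (auto intro: generate.incl)
  moreover have "free_on ?F {a, b}" by (rule free_on_generate[OF S red])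
  ultimately show ?thesis
    using sub unfolding contains_nonabelian_free_subgroup_def by blast
qed

end

section \<open>Normal forms in amalgamated products\<close>

text \<open>\<open>SOME\<close> is applied to the coset as a set, so the choice depends on the coset
  only. The coset \<open>H\<close> itself receives one, so that a trivial representative detects
  membership in \<open>H\<close>.\<close>

definition coset_rep :: "('a, 'm) monoid_scheme \<Rightarrow> 'a set \<Rightarrow> 'a \<Rightarrow> 'a" where
  "coset_rep G H g = (if g \<in> H then \<one>\<^bsub>G\<^esub> else SOME x. x \<in> H #>\<^bsub>G\<^esub> g)"

definition coset_part :: "('a, 'm) monoid_scheme \<Rightarrow> 'a set \<Rightarrow> 'a \<Rightarrow> 'a" where
  "coset_part G H g = g \<otimes>\<^bsub>G\<^esub> inv\<^bsub>G\<^esub> coset_rep G H g"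

context group
begin

lemma subgroup_mult_mem_iff:
  assumes "subgroup H G" "h \<in> H" "g \<in> carrier G"
  shows "h \<otimes> g \<in> H \<longleftrightarrow> g \<in> H" "g \<otimes> h \<in> H \<longleftrightarrow> g \<in> H"
proof -
  interpret H: subgroup H G by (rule assms(1))
  have "inv h \<otimes> (h \<otimes> g) = g" "(g \<otimes> h) \<otimes> inv h = g"
    using assms by (simp_all add: m_assoc[symmetric]) (simp add: m_assoc)
  then show "h \<otimes> g \<in> H \<longleftrightarrow> g \<in> H" "g \<otimes> h \<in> H \<longleftrightarrow> g \<in> H"
    using assms by (metis H.m_closed H.m_inv_closed)+
qed

lemma coset_rep_ex:
  assumes "subgroup H G" "g \<in> carrier G"
  shows "\<exists>h\<in>H. coset_rep G H g = h \<otimes> g"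
proof (cases "g \<in> H")
  case True
  then show ?thesis using assms
    by (intro bexI[of _ "inv g"]) (auto simp: coset_rep_def subgroup.m_inv_closed)
next
  case False
  have "g \<in> H #> g" using rcos_self assms by blast
  then have "(SOME x. x \<in> H #> g) \<in> H #> g" by (rule someI)
  then show ?thesis using False by (auto simp: coset_rep_def r_coset_def)
qed

lemma coset_rep_closed: "subgroup H G \<Longrightarrow> g \<in> carrier G \<Longrightarrow> coset_rep G H g \<in> carrier G"
  using coset_rep_ex subgroup.mem_carrier by fastforce

lemma coset_rep_mem_iff:
  "subgroup H G \<Longrightarrow> subgroup K G \<Longrightarrow> H \<subseteq> K \<Longrightarrow> g \<in> carrier G \<Longrightarrow> coset_rep G H g \<in> K \<longleftrightarrow> g \<in> K"
  using coset_rep_ex[of H g] subgroup_mult_mem_iff(1)[of K _ g] by auto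

lemma coset_rep_mult:
  assumes H: "subgroup H G" "h \<in> H" "g \<in> carrier G"
  shows "coset_rep G H (h \<otimes> g) = coset_rep G H g"
proof -
  have "h \<in> carrier G" using subgroup.mem_carrier[OF H(1,2)] .
  then have "H #> (h \<otimes> g) = H #> g"
    using coset_mult_assoc[OF subgroup.subset[OF H(1)], of h g] coset_join2[OF _ H(1,2)] H(3) by simp
  then show ?thesis using subgroup_mult_mem_iff(1)[OF H] by (simp add: coset_rep_def)
qed

lemma coset_rep_idem:
  assumes "subgroup H G" "g \<in> carrier G"
  shows "coset_rep G H (coset_rep G H g) = coset_rep G H g"
  using coset_rep_ex[OF assms] coset_rep_mult[OF assms(1) _ assms(2)] by auto

lemma coset_part_mem:
  assumes "subgroup H G" "g \<in> carrier G"
  shows "coset_part G H g \<in> H"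
proof -
  obtain h where h: "h \<in> H" "coset_rep G H g = h \<otimes> g" using coset_rep_ex[OF assms] by blast
  have "h \<in> carrier G" using subgroup.mem_carrier[OF assms(1) h(1)] .
  then have "coset_part G H g = inv h"
    using assms by (simp add: coset_part_def h inv_mult_group m_assoc[symmetric])
  then show ?thesis using h assms by (simp add: subgroup.m_inv_closed)
qed

lemma coset_part_rep:
  "subgroup H G \<Longrightarrow> g \<in> carrier G \<Longrightarrow> coset_part G H g \<otimes> coset_rep G H g = g"
  by (simp add: coset_part_def m_assoc coset_rep_closed)

lemma coset_part_mult:
  assumes "subgroup H G" "h \<in> H" "r \<in> carrier G" "coset_rep G H r = r"
  shows "coset_part G H (h \<otimes> r) = h"
  using assms subgroup.mem_carrier[OF assms(1,2)]
  by (simp add: coset_part_def coset_rep_mult m_assoc)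

text \<open>\<open>BijGroup\<close> consists of extensional maps, hence the restriction to
  \<open>\<Omega>\<close>; bijectivity holds because \<open>inv k\<close> undoes
  \<open>k\<close>.\<close>

lemma subgroup_action_hom:
  assumes K: "subgroup K G"
    and closed: "\<And>k z. k \<in> K \<Longrightarrow> z \<in> \<Omega> \<Longrightarrow> \<alpha> k z \<in> \<Omega>"
    and one: "\<And>z. z \<in> \<Omega> \<Longrightarrow> \<alpha> \<one> z = z"
    and mult: "\<And>k k' z. k \<in> K \<Longrightarrow> k' \<in> K \<Longrightarrow> z \<in> \<Omega> \<Longrightarrow> \<alpha> (k \<otimes> k') z = \<alpha> k (\<alpha> k' z)"
  shows "(\<lambda>k. \<lambda>z\<in>\<Omega>. \<alpha> k z) \<in> hom (G\<lparr>carrier := K\<rparr>) (BijGroup \<Omega>)"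
proof -
  interpret K: subgroup K G by (rule K)
  have bij: "(\<lambda>z\<in>\<Omega>. \<alpha> k z) \<in> Bij \<Omega>" if k: "k \<in> K" for k
  proof -
    have "\<alpha> (inv k) (\<alpha> k z) = z" "\<alpha> k (\<alpha> (inv k) z) = z" if "z \<in> \<Omega>" for z
      using mult[of "inv k" k z] mult[of k "inv k" z] k that one by auto
    then have "bij_betw (\<alpha> k) \<Omega> \<Omega>"
      using k closed by (intro bij_betwI[where g = "\<alpha> (inv k)"]) auto
    then show ?thesis by (auto simp: Bij_def cong: bij_betw_cong)
  qed
  show ?thesis
  proof (rule homI)
    fix k k' assume k: "k \<in> carrier (G\<lparr>carrier := K\<rparr>)" "k' \<in> carrier (G\<lparr>carrier := K\<rparr>)"
    show "(\<lambda>z\<in>\<Omega>. \<alpha> k z) \<in> carrier (BijGroup \<Omega>)" using bij k by (simp add: BijGroup_def)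
    show "(\<lambda>z\<in>\<Omega>. \<alpha> (k \<otimes>\<^bsub>G\<lparr>carrier := K\<rparr>\<^esub> k') z) =
        (\<lambda>z\<in>\<Omega>. \<alpha> k z) \<otimes>\<^bsub>BijGroup \<Omega>\<^esub> (\<lambda>z\<in>\<Omega>. \<alpha> k' z)"
      using bij k by (auto simp: BijGroup_def mult closed compose_def fun_eq_iff)
  qed
qed

lemma amalgamated_product_hom:
  assumes am: "amalgamated_product G A D B" and M: "group M"
    and f: "f \<in> hom (G\<lparr>carrier := A\<rparr>) M" and f': "f' \<in> hom (G\<lparr>carrier := B\<rparr>) M"
    and eq: "\<And>d. d \<in> D \<Longrightarrow> f d = f' d"
  shows "\<exists>\<rho>\<in>hom G M. (\<forall>x\<in>A. \<rho> x = f x) \<and> (\<forall>x\<in>B. \<rho> x = f' x)"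
proof -
  interpret M: group M by (rule M)
  have A: "subgroup A G" and B: "subgroup B G" and D: "D \<subseteq> A" "D \<subseteq> B"
    and pres: "has_presentation G (A <+> B)
      (mult_table G A Inl \<union> mult_table G B Inr \<union> {([(Inl h, True)], [(Inr h, True)]) | h. h \<in> D})
      (case_sum (\<lambda>a. a) (\<lambda>b. b))"
    using am by (auto simp: amalgamated_product_def)
  have c: "x \<in> A \<Longrightarrow> f x \<in> carrier M" "x \<in> B \<Longrightarrow> f' x \<in> carrier M" for x
    using f f' by (auto simp: hom_def)
  have m: "x \<in> A \<Longrightarrow> y \<in> A \<Longrightarrow> f (x \<otimes> y) = f x \<otimes>\<^bsub>M\<^esub> f y"
      "x \<in> B \<Longrightarrow> y \<in> B \<Longrightarrow> f' (x \<otimes> y) = f' x \<otimes>\<^bsub>M\<^esub> f' y" for x y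
    using f f' by (auto simp: hom_def)
  have "\<exists>\<rho>\<in>hom G M. \<forall>x\<in>A <+> B. \<rho> (case_sum (\<lambda>a. a) (\<lambda>b. b) x) = case_sum f f' x"
  proof (rule presentation_hom[OF pres M])
    show "case_sum f f' \<in> A <+> B \<rightarrow> carrier M" using c by auto
    fix u v
    assume "(u, v) \<in> mult_table G A Inl \<union> mult_table G B Inr \<union> {([(Inl h, True)], [(Inr h, True)]) | h. h \<in> D}"
    then consider x y where "x \<in> A" "y \<in> A" "u = [(Inl x, True), (Inl y, True)]" "v = [(Inl (x \<otimes> y), True)]"
      | x y where "x \<in> B" "y \<in> B" "u = [(Inr x, True), (Inr y, True)]" "v = [(Inr (x \<otimes> y), True)]"
      | h where "h \<in> D" "u = [(Inl h, True)]" "v = [(Inr h, True)]"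
      unfolding mult_table_def by blast
    then show "word_val M (case_sum f f') u = word_val M (case_sum f f') v"
      by cases (simp_all add: c m eq)
  qed
  then show ?thesis by (auto simp: Plus_def ball_Un)
qed

end

section \<open>The action of an amalgamated product on alternating normal forms\<close>

locale amalgam = group G for G :: "('a, 'm) monoid_scheme" (structure) +
  fixes P :: "bool \<Rightarrow> 'a set" and D :: "'a set"
  assumes P: "subgroup (P s) G" and D: "subgroup D G" and DP: "D \<subseteq> P s"
begin

text \<open>A pair \<open>(d, [(s\<^sub>1, r\<^sub>1), \<dots>, (s\<^sub>n, r\<^sub>n)])\<close> stands for the normal form \<open>d r\<^sub>1 \<cdots> r\<^sub>n\<close> with \<open>r\<^sub>i\<close> a
  coset representative in the factor \<open>P s\<^sub>i\<close>. The factors are tagged because \<open>P True \<inter> P False = D\<close> is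
  not known in advance.\<close>

definition nf_lists :: "(bool \<times> 'a) list set" where
  "nf_lists = {l. (\<forall>(s, r)\<in>set l. r \<in> P s - D \<and> coset_rep G D r = r) \<and>
    successively (\<lambda>a b. fst a \<noteq> fst b) l}"

definition nforms :: "('a \<times> (bool \<times> 'a) list) set" where
  "nforms = D \<times> nf_lists"

definition starts :: "bool \<Rightarrow> 'a \<times> (bool \<times> 'a) list \<Rightarrow> bool" where
  "starts s z \<longleftrightarrow> snd z \<noteq> [] \<and> fst (hd (snd z)) = s"

text \<open>\<open>split_nf s\<close> and \<open>join_nf s\<close> are mutually inverse between
  normal forms and pairs of an element of \<open>P s\<close> with a tail not starting on side
  \<open>s\<close>. In these coordinates the factor acts by left multiplication on the first entry,
  which makes the action laws immediate.\<close>

definition split_nf :: "bool \<Rightarrow> 'a \<times> (bool \<times> 'a) list \<Rightarrow> 'a \<times> (bool \<times> 'a) list" where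
  "split_nf s z = (if starts s z then (fst z \<otimes> snd (hd (snd z)), tl (snd z)) else z)"

definition join_nf :: "bool \<Rightarrow> 'a \<times> (bool \<times> 'a) list \<Rightarrow> 'a \<times> (bool \<times> 'a) list" where
  "join_nf s z = (if fst z \<in> D then z
    else (coset_part G D (fst z), (s, coset_rep G D (fst z)) # snd z))"

definition act :: "bool \<Rightarrow> 'a \<Rightarrow> 'a \<times> (bool \<times> 'a) list \<Rightarrow> 'a \<times> (bool \<times> 'a) list" where
  "act s x z = join_nf s (x \<otimes> fst (split_nf s z), snd (split_nf s z))"

lemma P_carrier: "x \<in> P s \<Longrightarrow> x \<in> carrier G"
  by (rule subgroup.mem_carrier[OF P])

lemma D_carrier: "x \<in> D \<Longrightarrow> x \<in> carrier G"
  by (rule subgroup.mem_carrier[OF D])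

lemma D_P: "x \<in> D \<Longrightarrow> x \<in> P s"
  using DP by blast

lemma split_nf_range:
  assumes "z \<in> nforms"
  shows "split_nf s z \<in> P s \<times> nf_lists" "\<not> starts s (split_nf s z)"
proof -
  obtain d l where z: "z = (d, l)" and d: "d \<in> D" and l: "l \<in> nf_lists"
    using assms by (auto simp: nforms_def)
  have "split_nf s z \<in> P s \<times> nf_lists \<and> \<not> starts s (split_nf s z)"
  proof (cases "starts s z")
    case True
    then obtain r l' where l': "l = (s, r) # l'" by (cases l) (auto simp: z starts_def)
    then have "d \<otimes> r \<in> P s" using l D_P[OF d] by (simp add: nf_lists_def subgroup.m_closed[OF P])
    then show ?thesis
      using l True by (auto simp: z l' split_nf_def starts_def nf_lists_def successively_Cons)
  qed (use d l D_P in \<open>auto simp: z split_nf_def\<close>)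
  then show "split_nf s z \<in> P s \<times> nf_lists" "\<not> starts s (split_nf s z)" by auto
qed

lemma join_nf_range:
  assumes "x \<in> P s" "l \<in> nf_lists" "\<not> starts s (x, l)"
  shows "join_nf s (x, l) \<in> nforms"
  using assms P_carrier[OF assms(1)]
  by (auto simp: join_nf_def nforms_def nf_lists_def successively_Cons starts_def
      coset_part_mem[OF D] coset_rep_idem[OF D] coset_rep_mem_iff[OF D P DP]
      coset_rep_mem_iff[OF D D])

lemma split_join:
  assumes "x \<in> P s" "l \<in> nf_lists" "\<not> starts s (x, l)"
  shows "split_nf s (join_nf s (x, l)) = (x, l)"
  using assms P_carrier[OF assms(1)]
  by (auto simp: join_nf_def split_nf_def starts_def coset_part_rep[OF D])

lemma join_split:
  assumes "z \<in> nforms"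
  shows "join_nf s (split_nf s z) = z"
proof -
  obtain d l where z: "z = (d, l)" and d: "d \<in> D" and l: "l \<in> nf_lists"
    using assms by (auto simp: nforms_def)
  show ?thesis
  proof (cases "starts s z")
    case True
    then obtain r l' where l': "l = (s, r) # l'" by (cases l) (auto simp: z starts_def)
    then have r: "r \<in> P s" "r \<notin> D" "coset_rep G D r = r" using l by (auto simp: nf_lists_def)
    then show ?thesis
      using d True subgroup_mult_mem_iff(1)[OF D d, of r] P_carrier[OF r(1)]
      by (simp add: z l' split_nf_def join_nf_def coset_part_mult[OF D] coset_rep_mult[OF D])
  qed (use d in \<open>auto simp: z split_nf_def join_nf_def\<close>)
qed

lemma act_pre:
  assumes "x \<in> P s" "z \<in> nforms"
  shows "x \<otimes> fst (split_nf s z) \<in> P s" "snd (split_nf s z) \<in> nf_lists"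
    "\<not> starts s (x \<otimes> fst (split_nf s z), snd (split_nf s z))"
  using split_nf_range[OF assms(2), of s] assms(1)
  by (auto simp: subgroup.m_closed[OF P] starts_def)

lemma act_closed: "x \<in> P s \<Longrightarrow> z \<in> nforms \<Longrightarrow> act s x z \<in> nforms"
  unfolding act_def by (intro join_nf_range act_pre)

lemma act_one: "z \<in> nforms \<Longrightarrow> act s \<one> z = z"
  using split_nf_range(1)[of z s] join_split[of z s] P_carrier by (auto simp: act_def)

lemma act_mult:
  assumes "x \<in> P s" "y \<in> P s" "z \<in> nforms"
  shows "act s (x \<otimes> y) z = act s x (act s y z)"
proof -
  have "fst (split_nf s z) \<in> carrier G"
    using split_nf_range(1)[OF assms(3), of s] P_carrier by auto
  then show ?thesis
    using act_pre[OF assms(2,3)] assms P_carrier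
    by (simp add: act_def split_join m_assoc)
qed

text \<open>The result does not involve \<open>s\<close>: both factors act alike on
  \<open>D\<close>, which is the compatibility needed to glue their actions.\<close>

lemma act_D:
  assumes d: "d \<in> D" and z: "z \<in> nforms"
  shows "act s d z = (d \<otimes> fst z, snd z)"
proof -
  obtain d' l where z': "z = (d', l)" and d': "d' \<in> D" and l: "l \<in> nf_lists"
    using z by (auto simp: nforms_def)
  have dd: "d \<otimes> d' \<in> D" by (rule subgroup.m_closed[OF D d d'])
  show ?thesis
  proof (cases "starts s z")
    case True
    then obtain r l' where l': "l = (s, r) # l'" by (cases l) (auto simp: z' starts_def)
    then have r: "r \<in> P s" "r \<notin> D" "coset_rep G D r = r" using l by (auto simp: nf_lists_def)
    have "d \<otimes> (d' \<otimes> r) = (d \<otimes> d') \<otimes> r"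
      using d d' D_carrier P_carrier[OF r(1)] by (simp add: m_assoc)
    then show ?thesis
      using True r dd subgroup_mult_mem_iff(1)[OF D dd, of r] P_carrier[OF r(1)]
      by (simp add: act_def z' l' split_nf_def join_nf_def coset_part_mult[OF D] coset_rep_mult[OF D])
  qed (use dd in \<open>auto simp: act_def z' split_nf_def join_nf_def\<close>)
qed

text \<open>There is no syllable of side \<open>s\<close> to absorb, so the new coefficient is
  \<open>x\<close> times an element of \<open>D\<close>. It stays outside \<open>D\<close>, and a
  syllable has to split off.\<close>

lemma starts_act:
  assumes "x \<in> P s - D" "z \<in> nforms" "\<not> starts s z"
  shows "starts s (act s x z)"
  using assms subgroup_mult_mem_iff(2)[OF D, of "fst z" x] P_carrier
  by (auto simp: act_def split_nf_def join_nf_def nforms_def starts_def)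

lemma normal_form_action:
  assumes "amalgamated_product G (P True) D (P False)"
  shows "\<exists>\<rho>. group_action G nforms \<rho> \<and> (\<forall>s. \<forall>x\<in>P s. \<forall>z\<in>nforms. \<rho> x z = act s x z)"
proof -
  have hom: "(\<lambda>k. \<lambda>z\<in>nforms. act s k z) \<in> hom (G\<lparr>carrier := P s\<rparr>) (BijGroup nforms)" for s
    by (rule subgroup_action_hom[OF P]) (auto simp: act_closed act_one act_mult)
  have "(\<lambda>z\<in>nforms. act True d z) = (\<lambda>z\<in>nforms. act False d z)" if "d \<in> D" for d
    using act_D[OF that] by (auto simp: fun_eq_iff)
  from amalgamated_product_hom[OF assms group_BijGroup hom hom this]
  obtain \<rho> where \<rho>: "\<rho> \<in> hom G (BijGroup nforms)"
    "\<forall>x\<in>P True. \<rho> x = (\<lambda>z\<in>nforms. act True x z)" "\<forall>x\<in>P False. \<rho> x = (\<lambda>z\<in>nforms. act False x z)"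
    by blast
  have "group_action G nforms \<rho>"
    using \<rho>(1) group_BijGroup[of nforms]
    by (auto simp: group_action_def group_hom_def group_hom_axioms_def is_group)
  moreover have "\<rho> x z = act s x z" if "x \<in> P s" "z \<in> nforms" for s x z
    using \<rho>(2,3) that by (cases s) auto
  ultimately show ?thesis by blast
qed

text \<open>The elements \<open>c\<^sub>1 e c\<^sub>2\<^sup>-\<^sup>1\<close> and its conjugate by \<open>e\<close> play ping-pong on the four cylinders of normal
  forms beginning with \<open>c\<^sub>1\<close>, \<open>c\<^sub>2\<close>, \<open>e c\<^sub>1\<close> and \<open>e c\<^sub>2\<close>.\<close>

lemma free_subgroup_if_index_gt_2:
  assumes am: "amalgamated_product G (P True) D (P False)"
    and c: "c\<^sub>1 \<in> P s - D" "c\<^sub>2 \<in> P s - D" "inv c\<^sub>2 \<otimes> c\<^sub>1 \<notin> D" and e: "e \<in> P (\<not> s) - D"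
  shows "contains_nonabelian_free_subgroup G"
proof -
  obtain \<rho> where act: "group_action G nforms \<rho>"
    and \<rho>: "\<And>s x z. x \<in> P s \<Longrightarrow> z \<in> nforms \<Longrightarrow> \<rho> x z = act s x z"
    using normal_form_action[OF am] by blast
  interpret act: group_action G nforms \<rho> by (rule act)
  have car: "c\<^sub>1 \<in> carrier G" "c\<^sub>2 \<in> carrier G" "e \<in> carrier G" using c e P_carrier by auto
  \<comment> \<open>These normal forms can follow a syllable from \<open>P s\<close> without
    cancellation, so the image of \<open>X\<close> under \<open>c\<close> is the cylinder of
    \<open>c\<close>.\<close>
  define X where "X = {z \<in> nforms. starts (\<not> s) z}"
  have st: "starts s' (\<rho> x z)" if "x \<in> P s' - D" "z \<in> nforms" "\<not> starts s' z" for s' x z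
    using starts_act[OF that] \<rho>[of x s' z] that by simp
  have im: "\<rho> x z \<in> nforms" if "x \<in> carrier G" "z \<in> nforms" for x z
    by (rule act.element_image[OF that HOL.refl])
  have inv: "inv x \<in> P s' - D" if "x \<in> P s' - D" for s' x
    using that subgroup.m_inv_closed[OF P, of x s'] subgroup.m_inv_closed[OF D, of "inv x"] P_carrier
    by auto
  \<comment> \<open>Undo \<open>y\<close>; outside \<open>X\<close> the element \<open>e'\<close>
    creates a syllable of side \<open>\<not> s\<close> and so leads into \<open>X\<close>; then
    apply \<open>x\<close>. All four ping-pong inclusions are instances.\<close>
  have step: "\<rho> (x \<otimes> e' \<otimes> inv y) z \<in> \<rho> x ` X"
    if xy: "x \<in> carrier G" "y \<in> carrier G" and e': "e' \<in> P (\<not> s) - D"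
      and z: "z \<in> nforms" "z \<notin> \<rho> y ` X" for x y e' z
  proof -
    let ?w = "\<rho> (inv y) z"
    have e'c: "e' \<in> carrier G" using e' P_carrier by blast
    have w: "?w \<in> nforms" using im xy z by simp
    have "\<rho> y ?w = z" using act.orbit_sym_aux[of "inv y" z] xy z by simp
    then have "?w \<notin> X" using z(2) by (metis image_eqI)
    then have "\<not> starts (\<not> s) ?w" using w by (simp add: X_def)
    then have "\<rho> e' ?w \<in> X" using st[OF e' w] im[OF e'c w] by (simp add: X_def)
    moreover have "\<rho> (x \<otimes> e' \<otimes> inv y) z = \<rho> x (\<rho> e' ?w)"
      using e'c xy z w by (simp add: act.composition_rule)
    ultimately show ?thesis by blast
  qed
  \<comment> \<open>Carrying one translate onto the other applies an element of
    \<open>P s - D\<close> to \<open>X\<close>, and this changes the side on which normal forms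
    start.\<close>
  have disj: "\<rho> x ` X \<inter> \<rho> y ` X = {}"
    if xy: "x \<in> carrier G" "y \<in> carrier G" "inv y \<otimes> x \<in> P s - D" for x y
  proof -
    have False if uv: "u \<in> X" "v \<in> X" "\<rho> x u = \<rho> y v" for u v
    proof -
      have "\<rho> (inv y \<otimes> x) u = v"
        using xy uv act.orbit_sym_aux[of y v] by (simp add: act.composition_rule X_def)
      moreover have "starts s (\<rho> (inv y \<otimes> x) u)"
        using st[OF xy(3), of u] uv(1) by (simp add: X_def starts_def)
      ultimately show False using uv by (auto simp: X_def starts_def)
    qed
    then show ?thesis by blast
  qed
  define a where "a = c\<^sub>1 \<otimes> e \<otimes> inv c\<^sub>2"
  \<comment> \<open>This is \<open>e a inv e\<close>: conjugation by \<open>e\<close> moves both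
    cylinders to side \<open>\<not> s\<close>, away from those of \<open>a\<close>.\<close>
  define b where "b = (e \<otimes> c\<^sub>1) \<otimes> e \<otimes> inv (e \<otimes> c\<^sub>2)"
  have inva: "inv a = c\<^sub>2 \<otimes> inv e \<otimes> inv c\<^sub>1"
    and invb: "inv b = (e \<otimes> c\<^sub>2) \<otimes> inv e \<otimes> inv (e \<otimes> c\<^sub>1)"
    using car by (simp_all add: a_def b_def inv_mult_group m_assoc)
  have startc: "starts s z" if "z \<in> \<rho> c\<^sub>1 ` X \<union> \<rho> c\<^sub>2 ` X" for z
    using that st[OF c(1)] st[OF c(2)] by (auto simp: X_def starts_def)
  have starte: "starts (\<not> s) z" if z: "z \<in> \<rho> (e \<otimes> c\<^sub>1) ` X \<union> \<rho> (e \<otimes> c\<^sub>2) ` X" for z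
  proof -
    obtain c u where u: "z = \<rho> (e \<otimes> c) u" "u \<in> X" "c \<in> {c\<^sub>1, c\<^sub>2}" using z by blast
    then have "z = \<rho> e (\<rho> c u)" using car by (auto simp: X_def act.composition_rule)
    moreover have "starts s (\<rho> c u)" "\<rho> c u \<in> nforms"
      using u startc[of "\<rho> c u"] car im[of c u] by (auto simp: X_def)
    ultimately show ?thesis using st[OF e, of "\<rho> c u"] by (auto simp: starts_def)
  qed
  have cc: "inv c\<^sub>2 \<otimes> c\<^sub>1 \<in> P s - D" using c P by (auto simp: subgroup.m_closed subgroup.m_inv_closed)
  moreover have "inv (e \<otimes> c\<^sub>2) \<otimes> (e \<otimes> c\<^sub>1) = inv c\<^sub>2 \<otimes> c\<^sub>1"
    using car by (simp add: inv_mult_group m_assoc) (simp add: m_assoc[symmetric])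
  ultimately have disjs: "\<rho> c\<^sub>1 ` X \<inter> \<rho> c\<^sub>2 ` X = {}" "\<rho> (e \<otimes> c\<^sub>1) ` X \<inter> \<rho> (e \<otimes> c\<^sub>2) ` X = {}"
    using disj[of c\<^sub>1 c\<^sub>2] disj[of "e \<otimes> c\<^sub>1" "e \<otimes> c\<^sub>2"] car by simp_all
  have not_both: "\<not> (starts s z \<and> starts (\<not> s) z)" and not_nil: "\<not> starts s' (\<one>, [])" for s' z
    by (auto simp: starts_def)
  show ?thesis
  \<comment> \<open>The sets are passed in the order \<open>A'\<close>, \<open>A\<close>,
    \<open>B'\<close>, \<open>B\<close>. The base point is the empty normal form, which lies in no
    cylinder.\<close>
  proof (rule ping_pong[OF act, of a b "(\<one>, [])" "\<rho> c\<^sub>2 ` X" "\<rho> c\<^sub>1 ` X"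
        "\<rho> (e \<otimes> c\<^sub>2) ` X" "\<rho> (e \<otimes> c\<^sub>1) ` X"])
    show "a \<in> carrier G" "b \<in> carrier G" using car by (simp_all add: a_def b_def)
    show "(\<one>, []) \<in> nforms" using subgroup.one_closed[OF D] by (simp add: nforms_def nf_lists_def)
    show "(\<rho> c\<^sub>1 ` X \<union> \<rho> c\<^sub>2 ` X) \<inter> (\<rho> (e \<otimes> c\<^sub>1) ` X \<union> \<rho> (e \<otimes> c\<^sub>2) ` X) = {}"
      using startc starte not_both by blast
    show "(\<one>, []) \<notin> \<rho> c\<^sub>1 ` X \<union> \<rho> c\<^sub>2 ` X \<union> \<rho> (e \<otimes> c\<^sub>1) ` X \<union> \<rho> (e \<otimes> c\<^sub>2) ` X"
      using startc starte not_nil by blast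
    fix z assume z: "z \<in> nforms"
    show "\<rho> a z \<in> \<rho> c\<^sub>1 ` X" if "z \<notin> \<rho> c\<^sub>2 ` X"
      unfolding a_def using car e z that by (intro step) auto
    show "\<rho> (inv a) z \<in> \<rho> c\<^sub>2 ` X" if "z \<notin> \<rho> c\<^sub>1 ` X"
      unfolding inva using car inv[OF e] z that by (intro step) auto
    show "\<rho> b z \<in> \<rho> (e \<otimes> c\<^sub>1) ` X" if "z \<notin> \<rho> (e \<otimes> c\<^sub>2) ` X"
      unfolding b_def using car e z that by (intro step) auto
    show "\<rho> (inv b) z \<in> \<rho> (e \<otimes> c\<^sub>2) ` X" if "z \<notin> \<rho> (e \<otimes> c\<^sub>1) ` X"
      unfolding invb using car inv[OF e] z that by (intro step) auto
  qed (use disjs in auto)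
qed

end

section \<open>Normal forms in HNN extensions\<close>

context group
begin

lemma hnn_extension_hom:
  assumes hnn: "hnn_extension G A H \<theta> t" and M: "group M"
    and f: "f \<in> hom (G\<lparr>carrier := A\<rparr>) M" and \<tau>: "\<tau> \<in> carrier M"
    and rel: "\<And>h. h \<in> H \<Longrightarrow> f h \<otimes>\<^bsub>M\<^esub> \<tau> = \<tau> \<otimes>\<^bsub>M\<^esub> f (\<theta> h)"
  shows "\<exists>\<rho>\<in>hom G M. \<rho> t = \<tau> \<and> (\<forall>x\<in>A. \<rho> x = f x)"
proof -
  interpret M: group M by (rule M)
  have A: "subgroup A G" and HA: "H \<subseteq> A" and \<theta>: "\<theta> \<in> H \<rightarrow> A"
    and pres: "has_presentation G (insert None (Some ` A))
      (mult_table G A Some \<union>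
        {([(None, False), (Some h, True), (None, True)], [(Some (\<theta> h), True)]) | h. h \<in> H})
      (case_option t (\<lambda>a. a))"
    using hnn by (auto simp: hnn_extension_def mon_def hom_def)
  have c: "x \<in> A \<Longrightarrow> f x \<in> carrier M" for x
    using f by (auto simp: hom_def)
  have m: "x \<in> A \<Longrightarrow> y \<in> A \<Longrightarrow> f (x \<otimes> y) = f x \<otimes>\<^bsub>M\<^esub> f y" for x y
    using f by (auto simp: hom_def)
  have "\<exists>\<rho>\<in>hom G M. \<forall>x\<in>insert None (Some ` A). \<rho> (case_option t (\<lambda>a. a) x) = case_option \<tau> f x"
  proof (rule presentation_hom[OF pres M])
    show "case_option \<tau> f \<in> insert None (Some ` A) \<rightarrow> carrier M" using c \<tau> by auto
    fix u v
    assume "(u, v) \<in> mult_table G A Some \<union>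
        {([(None, False), (Some h, True), (None, True)], [(Some (\<theta> h), True)]) | h. h \<in> H}"
    then consider x y where "x \<in> A" "y \<in> A" "u = [(Some x, True), (Some y, True)]" "v = [(Some (x \<otimes> y), True)]"
      | h where "h \<in> H" "u = [(None, False), (Some h, True), (None, True)]" "v = [(Some (\<theta> h), True)]"
      unfolding mult_table_def by blast
    then show "word_val M (case_option \<tau> f) u = word_val M (case_option \<tau> f) v"
    proof cases
      case 2
      have "f (\<theta> h) \<in> carrier M" using c \<theta> 2 by auto
      then show ?thesis using 2 \<tau> rel by (simp add: M.m_assoc[symmetric])
    qed (simp add: c m)
  qed
  then show ?thesis by auto
qed

lemma hnn_extension_props:
  assumes hnn: "hnn_extension G A H \<theta> t"
  shows "subgroup A G" "subgroup H G" "H \<subseteq> A" "t \<in> carrier G"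
    "\<theta> \<in> hom (G\<lparr>carrier := H\<rparr>) (G\<lparr>carrier := A\<rparr>)" "inj_on \<theta> H"
    "generate G (insert t A) = carrier G"
    "\<And>h. h \<in> H \<Longrightarrow> inv t \<otimes> h \<otimes> t = \<theta> h"
proof -
  have pres: "has_presentation G (insert None (Some ` A))
      (mult_table G A Some \<union>
        {([(None, False), (Some h, True), (None, True)], [(Some (\<theta> h), True)]) | h. h \<in> H})
      (case_option t (\<lambda>a. a))"
    and \<theta>: "\<theta> \<in> H \<rightarrow> A"
    using hnn by (auto simp: hnn_extension_def mon_def hom_def)
  show A: "subgroup A G" "subgroup H G" "H \<subseteq> A" "t \<in> carrier G"
    "\<theta> \<in> hom (G\<lparr>carrier := H\<rparr>) (G\<lparr>carrier := A\<rparr>)" "inj_on \<theta> H"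
    using hnn by (auto simp: hnn_extension_def mon_def)
  show "generate G (insert t A) = carrier G"
    using presentation_generate(1)[OF pres] by (simp add: image_image)
  fix h assume h: "h \<in> H"
  have "word_val G (case_option t (\<lambda>a. a)) [(None, False), (Some h, True), (None, True)] =
      word_val G (case_option t (\<lambda>a. a)) [(Some (\<theta> h), True)]"
    using A \<theta> h by (intro presentation_relation[OF pres]) auto
  moreover have "h \<in> carrier G" "\<theta> h \<in> carrier G"
    using A(1,3) \<theta> h by (auto dest: subgroup.mem_carrier)
  ultimately show "inv t \<otimes> h \<otimes> t = \<theta> h" using A(4) by (simp add: m_assoc)
qed

end

text \<open>\<open>Q s\<close> is the subgroup of the base that the stable letter \<open>tt s\<close> (\<open>t\<close> or its inverse) conjugates
  into the base, with image \<open>Q (\<not> s)\<close>.\<close>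

locale hnn = group G for G :: "('a, 'm) monoid_scheme" (structure) +
  fixes A :: "'a set" and Q :: "bool \<Rightarrow> 'a set" and t :: 'a
  assumes A: "subgroup A G" and Q: "subgroup (Q s) G" and QA: "Q s \<subseteq> A" and t: "t \<in> carrier G"
    and Q_conj: "k \<in> Q True \<Longrightarrow> t \<otimes> k \<otimes> inv t \<in> Q False"
      "k \<in> Q False \<Longrightarrow> inv t \<otimes> k \<otimes> t \<in> Q True"
begin

definition tt :: "bool \<Rightarrow> 'a" where
  "tt s = (if s then t else inv t)"

text \<open>The condition on neighbours forbids pinches: between a stable letter and its inverse the
  representative is nontrivial.\<close>

definition nf_lists :: "(bool \<times> 'a) list set" where
  "nf_lists = {l. (\<forall>(s, r)\<in>set l. r \<in> A \<and> coset_rep G (Q s) r = r) \<and>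
    successively (\<lambda>a b. fst b = (\<not> fst a) \<longrightarrow> snd a \<noteq> \<one>) l}"

text \<open>\<open>(a, [(s\<^sub>1, r\<^sub>1), \<dots>, (s\<^sub>n, r\<^sub>n)])\<close> stands for Britton's normal form \<open>a (tt s\<^sub>1) r\<^sub>1 \<cdots> (tt s\<^sub>n) r\<^sub>n\<close>.\<close>

definition nforms :: "('a \<times> (bool \<times> 'a) list) set" where
  "nforms = A \<times> nf_lists"

definition starts :: "bool \<Rightarrow> 'a \<times> (bool \<times> 'a) list \<Rightarrow> bool" where
  "starts s z \<longleftrightarrow> snd z \<noteq> [] \<and> fst (hd (snd z)) = s"

text \<open>Left multiplication by \<open>tt s\<close>. Write the coefficient as \<open>p r\<close>
  with \<open>p\<close> in \<open>Q s\<close>; the stable letter passes \<open>p\<close> by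
  conjugation, and \<open>tt s\<close> followed by \<open>r\<close> either forms a new syllable or,
  if \<open>r\<close> is one, cancels against an inverse stable letter.\<close>

definition turn :: "bool \<Rightarrow> 'a \<times> (bool \<times> 'a) list \<Rightarrow> 'a \<times> (bool \<times> 'a) list" where
  "turn s z = (let k = tt s \<otimes> coset_part G (Q s) (fst z) \<otimes> inv tt s; r = coset_rep G (Q s) (fst z) in
    if r = \<one> \<and> starts (\<not> s) z then (k \<otimes> snd (hd (snd z)), tl (snd z)) else (k, (s, r) # snd z))"

lemma tt_closed [simp]: "tt s \<in> carrier G" and inv_tt: "inv tt s = tt (\<not> s)"
  using t by (auto simp: tt_def)

lemma A_carrier: "x \<in> A \<Longrightarrow> x \<in> carrier G"
  by (rule subgroup.mem_carrier[OF A])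

lemma Q_A: "x \<in> Q s \<Longrightarrow> x \<in> A"
  using QA by blast

lemma conj_closed: "k \<in> Q s \<Longrightarrow> tt s \<otimes> k \<otimes> inv tt s \<in> Q (\<not> s)"
  using Q_conj t by (cases s) (auto simp: tt_def)

lemma conj_conj: "k \<in> carrier G \<Longrightarrow> tt (\<not> s) \<otimes> (tt s \<otimes> k \<otimes> inv tt s) \<otimes> inv tt (\<not> s) = k"
  by (simp add: inv_tt[symmetric] m_assoc) (simp add: m_assoc[symmetric])

lemma rep_eq_one_iff: "a \<in> A \<Longrightarrow> coset_rep G (Q s) a = \<one> \<longleftrightarrow> a \<in> Q s"
  using coset_rep_mem_iff[OF Q Q order_refl, of a s] A_carrier subgroup.one_closed[OF Q, of s]
  by (auto simp: coset_rep_def)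

lemma turn_closed:
  assumes "z \<in> nforms"
  shows "turn s z \<in> nforms"
proof -
  obtain a l where z: "z = (a, l)" "a \<in> A" "l \<in> nf_lists" using assms by (auto simp: nforms_def)
  have ac: "a \<in> carrier G" by (rule A_carrier[OF z(2)])
  have k: "tt s \<otimes> coset_part G (Q s) a \<otimes> inv tt s \<in> A"
    by (rule Q_A[OF conj_closed[OF coset_part_mem[OF Q ac]]])
  have r: "coset_rep G (Q s) a \<in> A" "coset_rep G (Q s) (coset_rep G (Q s) a) = coset_rep G (Q s) a"
    using coset_rep_mem_iff[OF Q A QA ac] coset_rep_idem[OF Q ac] z by auto
  show ?thesis
  proof (cases "coset_rep G (Q s) a = \<one> \<and> starts (\<not> s) z")
    case True
    then obtain r' l' where l: "l = (\<not> s, r') # l'" by (cases l) (auto simp: z starts_def)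
    then have "r' \<in> A" "l' \<in> nf_lists" using z by (auto simp: nf_lists_def successively_Cons)
    then show ?thesis using k True by (simp add: turn_def z l nforms_def subgroup.m_closed[OF A])
  next
    case False
    then show ?thesis using k r z
      by (auto simp: turn_def nforms_def nf_lists_def successively_Cons starts_def)
  qed
qed

text \<open>Prepending and cancelling undo each other. The delicate case is a cancelled syllable
  with representative one: since \<open>z\<close> has no pinch, the remaining list does not start
  with \<open>s\<close>, so turning back cannot cancel once more.\<close>

lemma turn_turn:
  assumes "z \<in> nforms"
  shows "turn (\<not> s) (turn s z) = z"
proof -
  obtain a l where z: "z = (a, l)" "a \<in> A" "l \<in> nf_lists" using assms by (auto simp: nforms_def)
  have ac: "a \<in> carrier G" by (rule A_carrier[OF z(2)])
  define p where "p = coset_part G (Q s) a"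
  define k where "k = tt s \<otimes> p \<otimes> inv tt s"
  have p: "p \<in> Q s" unfolding p_def by (rule coset_part_mem[OF Q ac])
  have pc: "p \<in> carrier G" by (rule A_carrier[OF Q_A[OF p]])
  have k: "k \<in> Q (\<not> s)" unfolding k_def by (rule conj_closed[OF p])
  have kc: "k \<in> carrier G" by (rule A_carrier[OF Q_A[OF k]])
  have ap: "p \<otimes> coset_rep G (Q s) a = a" unfolding p_def by (rule coset_part_rep[OF Q ac])
  have kk: "tt (\<not> s) \<otimes> k \<otimes> inv tt (\<not> s) = p" unfolding k_def by (rule conj_conj[OF pc])
  have one: "coset_rep G (Q (\<not> s)) \<one> = \<one>" using subgroup.one_closed[OF Q] by (simp add: coset_rep_def)
  show ?thesis
  proof (cases "coset_rep G (Q s) a = \<one> \<and> starts (\<not> s) z")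
    case True
    then obtain r' l' where l: "l = (\<not> s, r') # l'" by (cases l) (auto simp: z starts_def)
    then have r': "r' \<in> A" "coset_rep G (Q (\<not> s)) r' = r'" "r' = \<one> \<Longrightarrow> \<not> starts s (x, l')" for x
      using z by (auto simp: nf_lists_def successively_Cons starts_def)
    have r'c: "r' \<in> carrier G" by (rule A_carrier[OF r'(1)])
    have "turn s z = (k \<otimes> r', l')" using True by (simp add: turn_def z l p_def k_def)
    moreover have "coset_part G (Q (\<not> s)) (k \<otimes> r') = k" "coset_rep G (Q (\<not> s)) (k \<otimes> r') = r'"
      using coset_part_mult[OF Q k r'c r'(2)] coset_rep_mult[OF Q k r'c] r'(2) by auto
    moreover have "\<not> (r' = \<one> \<and> starts s (k \<otimes> r', l'))" using r'(3) by blast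
    ultimately show ?thesis using True ap pc kk by (auto simp: turn_def z l)
  next
    case False
    then have "turn s z = (k, (s, coset_rep G (Q s) a) # l)" by (auto simp: turn_def z p_def k_def)
    moreover have "coset_part G (Q (\<not> s)) k = k" "coset_rep G (Q (\<not> s)) k = \<one>"
      using coset_part_mult[OF Q k one_closed one] coset_rep_mult[OF Q k one_closed] one kc by auto
    ultimately show ?thesis using ap kk by (simp add: turn_def z starts_def)
  qed
qed

text \<open>Multiplication by \<open>k\<close> changes the coset part but not the representative, so
  \<open>turn\<close> takes the same branch. The identity is the HNN relation for the
  action.\<close>

lemma turn_mult:
  assumes "z \<in> nforms" "k \<in> Q s"
  shows "turn s (k \<otimes> fst z, snd z) =
    ((tt s \<otimes> k \<otimes> inv tt s) \<otimes> fst (turn s z), snd (turn s z))"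
proof -
  obtain a l where z: "z = (a, l)" "a \<in> A" "l \<in> nf_lists" using assms by (auto simp: nforms_def)
  have ac: "a \<in> carrier G" by (rule A_carrier[OF z(2)])
  define p where "p = coset_part G (Q s) a"
  define k' p' where "k' = tt s \<otimes> k \<otimes> inv tt s" and "p' = tt s \<otimes> p \<otimes> inv tt s"
  have pc: "p \<in> carrier G" unfolding p_def by (rule A_carrier[OF Q_A[OF coset_part_mem[OF Q ac]]])
  have kc: "k \<in> carrier G" by (rule A_carrier[OF Q_A[OF assms(2)]])
  have k'c: "k' \<in> carrier G" and p'c: "p' \<in> carrier G" using kc pc by (simp_all add: k'_def p'_def)
  have r: "coset_rep G (Q s) (k \<otimes> a) = coset_rep G (Q s) a"
    by (rule coset_rep_mult[OF Q assms(2) ac])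
  have "coset_part G (Q s) (k \<otimes> a) = k \<otimes> p"
    using kc ac coset_rep_closed[OF Q ac] by (simp add: coset_part_def r p_def m_assoc)
  moreover have "tt s \<otimes> (k \<otimes> p) \<otimes> inv tt s = k' \<otimes> p'"
    unfolding k'_def p'_def using kc pc by (simp add: m_assoc) (simp add: m_assoc[symmetric])
  moreover have "snd (hd l) \<in> carrier G" if "l \<noteq> []"
    using z that A_carrier by (cases l) (auto simp: nf_lists_def)
  ultimately show ?thesis
    using r kc pc
    by (auto simp: turn_def z p_def[symmetric] k'_def[symmetric] p'_def[symmetric] starts_def Let_def k'c p'c m_assoc)
qed

lemma normal_form_action:
  assumes hnn: "hnn_extension G A (Q False) \<theta> t"
  shows "\<exists>\<rho>. group_action G nforms \<rho> \<and> (\<forall>x\<in>A. \<forall>z\<in>nforms. \<rho> x z = (x \<otimes> fst z, snd z)) \<and>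
    (\<forall>s. \<forall>z\<in>nforms. \<rho> (tt s) z = turn s z)"
proof -
  interpret B: group "BijGroup nforms" by (rule group_BijGroup)
  define f where "f k = (\<lambda>z\<in>nforms. (k \<otimes> fst z, snd z))" for k
  define \<tau> where "\<tau> = (\<lambda>z\<in>nforms. turn True z)"
  have f: "f \<in> hom (G\<lparr>carrier := A\<rparr>) (BijGroup nforms)"
    unfolding f_def
    by (rule subgroup_action_hom[OF A])
      (auto simp: nforms_def A_carrier m_assoc subgroup.m_closed[OF A])
  have fB: "f k \<in> Bij nforms" if "k \<in> A" for k
    using f that by (auto simp: hom_def BijGroup_def)
  have "bij_betw (turn True) nforms nforms"
    using turn_turn[of _ True] turn_turn[of _ False] turn_closed
    by (intro bij_betwI[where g = "turn False"]) auto
  then have \<tau>: "\<tau> \<in> Bij nforms" by (auto simp: \<tau>_def Bij_def cong: bij_betw_cong)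
  have rel: "f h \<otimes>\<^bsub>BijGroup nforms\<^esub> \<tau> = \<tau> \<otimes>\<^bsub>BijGroup nforms\<^esub> f (\<theta> h)" if h: "h \<in> Q False" for h
  proof -
    have hc: "h \<in> carrier G" by (rule A_carrier[OF Q_A[OF h]])
    have \<theta>: "\<theta> h = inv t \<otimes> h \<otimes> t" using hnn_extension_props(8)[OF hnn h] by simp
    then have \<theta>h: "\<theta> h \<in> Q True" using Q_conj(2)[OF h] by simp
    have "tt True \<otimes> \<theta> h \<otimes> inv tt True = h"
      using hc t by (simp add: tt_def \<theta> m_assoc) (simp add: m_assoc[symmetric])
    then have "turn True (\<theta> h \<otimes> fst z, snd z) = (h \<otimes> fst (turn True z), snd (turn True z))"
      if "z \<in> nforms" for z
      using turn_mult[OF that \<theta>h] by simp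
    moreover have "(\<theta> h \<otimes> fst z, snd z) \<in> nforms" if "z \<in> nforms" for z
      using that Q_A[OF \<theta>h] by (auto simp: nforms_def subgroup.m_closed[OF A])
    ultimately show ?thesis
      using \<tau> fB[OF Q_A[OF h]] fB[OF Q_A[OF \<theta>h]] turn_closed
      by (auto simp: BijGroup_def compose_def fun_eq_iff f_def \<tau>_def)
  qed
  have "\<tau> \<in> carrier (BijGroup nforms)" using \<tau> by (simp add: BijGroup_def)
  from hnn_extension_hom[OF hnn group_BijGroup f this rel]
  obtain \<rho> where \<rho>: "\<rho> \<in> hom G (BijGroup nforms)" "\<rho> t = \<tau>" "\<forall>x\<in>A. \<rho> x = f x" by blast
  have act: "group_action G nforms \<rho>"
    using \<rho>(1) group_BijGroup[of nforms]
    by (auto simp: group_action_def group_hom_def group_hom_axioms_def is_group)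
  interpret act: group_action G nforms \<rho> by (rule act)
  have 1: "\<rho> t z = turn True z" if "z \<in> nforms" for z using \<rho>(2) that by (simp add: \<tau>_def)
  have "\<rho> (tt s) z = turn s z" if "z \<in> nforms" for s z
  proof (cases s)
    case False
    have "\<rho> t (turn False z) = z"
      using 1[OF turn_closed[OF that]] turn_turn[OF that, of False] by simp
    then have "\<rho> (inv t) z = turn False z"
      using act.orbit_sym_aux[OF t turn_closed[OF that]] by blast
    then show ?thesis using False by (simp add: tt_def)
  qed (use 1 that in \<open>simp add: tt_def\<close>)
  moreover have "\<rho> x z = (x \<otimes> fst z, snd z)" if "x \<in> A" "z \<in> nforms" for x z
    using \<rho>(3) that by (simp add: f_def)
  ultimately show ?thesis using act by blast
qed

text \<open>The elements \<open>t\<close> and \<open>x t y\<close> play ping-pong: no freely reduced word in them admits a Britton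
  reduction.\<close>

lemma free_subgroup_if_not_ascending:
  assumes hnn: "hnn_extension G A (Q False) \<theta> t" and x: "x \<in> A - Q False" and y: "y \<in> A - Q True"
  shows "contains_nonabelian_free_subgroup G"
proof -
  obtain \<rho> where act: "group_action G nforms \<rho>"
    and \<rho>A: "\<And>x z. x \<in> A \<Longrightarrow> z \<in> nforms \<Longrightarrow> \<rho> x z = (x \<otimes> fst z, snd z)"
    and \<rho>t: "\<And>s z. z \<in> nforms \<Longrightarrow> \<rho> (tt s) z = turn s z"
    using normal_form_action[OF hnn] by blast
  interpret act: group_action G nforms \<rho> by (rule act)
  \<comment> \<open>\<open>Y (\<not> s)\<close> is exactly where \<open>turn s\<close> cancels, and
    from everywhere else \<open>turn s\<close> leads into \<open>Y s\<close>.\<close>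
  define Y where "Y s = {z \<in> nforms. starts s z \<and> fst z \<in> Q (\<not> s)}" for s
  have turn: "turn s z \<in> Y s" if "z \<in> nforms" "z \<notin> Y (\<not> s)" for s z
  proof -
    have a: "fst z \<in> A" using that by (auto simp: nforms_def)
    have "\<not> (coset_rep G (Q s) (fst z) = \<one> \<and> starts (\<not> s) z)"
      using that a by (auto simp: Y_def rep_eq_one_iff)
    then have "turn s z = (tt s \<otimes> coset_part G (Q s) (fst z) \<otimes> inv tt s,
        (s, coset_rep G (Q s) (fst z)) # snd z)"
      by (auto simp: turn_def)
    then show ?thesis
      using turn_closed[OF that(1), of s] conj_closed[OF coset_part_mem[OF Q A_carrier[OF a]], of s]
      by (simp add: Y_def starts_def)
  qed
  have step: "\<rho> (u \<otimes> tt s \<otimes> v) z \<in> \<rho> u ` Y s"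
    if u: "u \<in> carrier G" and v: "v \<in> carrier G" and z: "z \<in> nforms" "z \<notin> \<rho> (inv v) ` Y (\<not> s)"
    for u v s z
  proof -
    have w: "\<rho> v z \<in> nforms" by (rule act.element_image[OF v z(1) HOL.refl])
    have "\<rho> (inv v) (\<rho> v z) = z" by (rule act.orbit_sym_aux[OF v z(1) HOL.refl])
    then have "\<rho> v z \<notin> Y (\<not> s)" using z(2) by (metis image_eqI)
    then have "\<rho> (tt s) (\<rho> v z) \<in> Y s" using turn[OF w] \<rho>t[OF w] by simp
    moreover have "\<rho> (u \<otimes> tt s \<otimes> v) z = \<rho> u (\<rho> (tt s) (\<rho> v z))"
      using u v z w by (simp add: act.composition_rule)
    ultimately show ?thesis by blast
  qed
  have car: "x \<in> carrier G" "y \<in> carrier G" using x y A_carrier by auto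
  have iy: "inv y \<in> A" using y by (simp add: subgroup.m_inv_closed[OF A])
  have inv_b: "inv (x \<otimes> tt True \<otimes> y) = inv y \<otimes> tt False \<otimes> inv x"
    using car inv_tt[of True] by (simp add: inv_mult_group m_assoc)
  have one: "\<rho> \<one> ` Y s = Y s" for s
    using \<rho>A[OF subgroup.one_closed[OF A]] A_carrier by (force simp: Y_def nforms_def image_def)
  have st: "starts s z" if "z \<in> Y s \<union> \<rho> u ` Y s" "u \<in> A" for s z u
    using that \<rho>A by (auto simp: Y_def starts_def)
  \<comment> \<open>Elements of \<open>Y s\<close> have their coefficient in
    \<open>Q (\<not> s)\<close>, and \<open>u\<close> moves it out. This is applied to
    \<open>x\<close> outside \<open>Q False\<close> and to \<open>inv y\<close> outside
    \<open>Q True\<close>.\<close>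
  have disj: "Y s \<inter> \<rho> u ` Y s = {}" if u: "u \<in> A" "u \<notin> Q (\<not> s)" for s u
  proof -
    have "u \<otimes> fst w \<notin> Q (\<not> s)" if "w \<in> Y s" for w
      using that subgroup_mult_mem_iff(2)[OF Q, of "fst w" "\<not> s" u] u A_carrier by (auto simp: Y_def)
    then show ?thesis using \<rho>A u by (fastforce simp: Y_def)
  qed
  have not_both: "\<not> (starts True z \<and> starts False z)" and not_nil: "\<not> starts s (\<one>, [])" for s z
    by (auto simp: starts_def)
  have stT: "starts True z" if "z \<in> Y True \<union> \<rho> x ` Y True" for z using st[OF that] x by simp
  have stF: "starts False z" if "z \<in> Y False \<union> \<rho> (inv y) ` Y False" for z using st[OF that iy] .
  have iy': "inv y \<notin> Q True"
    using y car subgroup.m_inv_closed[OF Q, of "inv y" True] by auto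
  show ?thesis
  proof (rule ping_pong[OF act, of "tt True" "x \<otimes> tt True \<otimes> y" "(\<one>, [])" "Y False" "Y True"
        "\<rho> (inv y) ` Y False" "\<rho> x ` Y True"])
    show "tt True \<in> carrier G" "x \<otimes> tt True \<otimes> y \<in> carrier G" using car by simp_all
    show "(\<one>, []) \<in> nforms" using subgroup.one_closed[OF A] by (simp add: nforms_def nf_lists_def)
    show "(Y True \<union> Y False) \<inter> (\<rho> x ` Y True \<union> \<rho> (inv y) ` Y False) = {}"
      unfolding Int_Un_distrib Int_Un_distrib2 Un_empty
    proof (intro conjI)
      show "Y True \<inter> \<rho> x ` Y True = {}" "Y False \<inter> \<rho> (inv y) ` Y False = {}"
        using disj[of x True] disj[of "inv y" False] iy' x iy by simp_all
      show "Y True \<inter> \<rho> (inv y) ` Y False = {}" "Y False \<inter> \<rho> x ` Y True = {}"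
        using stT stF not_both by blast+
    qed
    show "Y True \<inter> Y False = {}" "\<rho> x ` Y True \<inter> \<rho> (inv y) ` Y False = {}"
      "(\<one>, []) \<notin> Y True \<union> Y False \<union> \<rho> x ` Y True \<union> \<rho> (inv y) ` Y False"
      using stT stF not_both not_nil by blast+
    fix z assume z: "z \<in> nforms"
    show "\<rho> (tt True) z \<in> Y True" if "z \<notin> Y False"
      using turn[OF z] that \<rho>t[OF z] by simp
    show "\<rho> (inv tt True) z \<in> Y False" if "z \<notin> Y True"
      using turn[OF z, of False] that \<rho>t[OF z] by (simp add: inv_tt)
    show "\<rho> (x \<otimes> tt True \<otimes> y) z \<in> \<rho> x ` Y True" if "z \<notin> \<rho> (inv y) ` Y False"
      using step[OF car z, of True] that by simp
    show "\<rho> (inv (x \<otimes> tt True \<otimes> y)) z \<in> \<rho> (inv y) ` Y False" if "z \<notin> \<rho> x ` Y True"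
      using step[of "inv y" "inv x" z False] car z that by (simp add: inv_b)
  qed
qed

end

context group
begin

lemma hnn_extension_ascending:
  assumes hnn: "hnn_extension G A H \<theta> t" and free: "\<not> contains_nonabelian_free_subgroup G"
  shows "H = A \<or> \<theta> ` H = A"
proof -
  note h = hnn_extension_props[OF hnn]
  have \<theta>: "\<theta> ` H \<subseteq> A" using h(5) by (auto simp: hom_def)
  have sub: "subgroup (\<theta> ` H) G"
  proof -
    interpret H: group "G\<lparr>carrier := H\<rparr>" by (rule subgroup_imp_group[OF h(2)])
    interpret A: group "G\<lparr>carrier := A\<rparr>" by (rule subgroup_imp_group[OF h(1)])
    interpret group_hom "G\<lparr>carrier := H\<rparr>" "G\<lparr>carrier := A\<rparr>" \<theta>
      using h(5) by unfold_locales
    show ?thesis using img_is_subgroup incl_subgroup[OF h(1)] by simp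
  qed
  \<comment> \<open>\<open>\<theta>\<close> is conjugation by \<open>inv t\<close>, so its domain
    \<open>H\<close> is the subgroup at \<open>False\<close> and its image the one at
    \<open>True\<close>.\<close>
  interpret hnn G A "\<lambda>s. if s then \<theta> ` H else H" t
  proof (intro hnn.intro hnn_axioms.intro is_group)
    show "subgroup A G" "t \<in> carrier G" by (rule h)+
    show "subgroup (if s then \<theta> ` H else H) G" "(if s then \<theta> ` H else H) \<subseteq> A" for s
      using sub h(2,3) \<theta> by simp_all
    show "inv t \<otimes> k \<otimes> t \<in> (if True then \<theta> ` H else H)" if "k \<in> (if False then \<theta> ` H else H)" for k
      using that h(8) by simp
    show "t \<otimes> k \<otimes> inv t \<in> (if False then \<theta> ` H else H)" if k: "k \<in> (if True then \<theta> ` H else H)" for k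
    proof -
      obtain x where x: "x \<in> H" "k = \<theta> x" using k by auto
      have "x \<in> carrier G" by (rule subgroup.mem_carrier[OF h(2) x(1)])
      then have "t \<otimes> (inv t \<otimes> x \<otimes> t) \<otimes> inv t = x"
        using h(4) by (simp add: m_assoc) (simp add: m_assoc[symmetric])
      then show ?thesis using x h(8) by simp
    qed
  qed
  show ?thesis
    using free_subgroup_if_not_ascending[of \<theta>] hnn free h(3) \<theta> by auto
qed

end

section \<open>Infinite dihedral quotients\<close>

text \<open>\<open>(False, n)\<close> is the translation \<open>z \<mapsto> n + z\<close> of the integers, \<open>(True, n)\<close> the reflection
  \<open>z \<mapsto> n - z\<close>.\<close>

definition dihedral :: "(bool \<times> int) monoid" where
  "dihedral = \<lparr>carrier = UNIV,
    mult = (\<lambda>(s, n) (r, m). (s \<noteq> r, if s then n - m else n + m)), one = (False, 0)\<rparr>"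

lemma dihedral_simps [simp]:
  "carrier dihedral = UNIV" "\<one>\<^bsub>dihedral\<^esub> = (False, 0)"
  "(s, n) \<otimes>\<^bsub>dihedral\<^esub> (r, m) = (s \<noteq> r, if s then n - m else n + m)"
  by (simp_all add: dihedral_def)

lemma group_dihedral: "group dihedral"
proof (rule groupI)
  fix x :: "bool \<times> int"
  obtain s n where x: "x = (s, n)" by force
  have "(s, if s then n else - n) \<otimes>\<^bsub>dihedral\<^esub> x = \<one>\<^bsub>dihedral\<^esub>" by (simp add: x)
  then show "\<exists>y\<in>carrier dihedral. y \<otimes>\<^bsub>dihedral\<^esub> x = \<one>\<^bsub>dihedral\<^esub>" by (intro bexI) simp_all
qed (auto split: if_splits)

lemma inv_dihedral [simp]: "inv\<^bsub>dihedral\<^esub> (s, n) = (s, if s then n else - n)"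
  by (rule group.inv_equality[OF group_dihedral]) simp_all

locale dihedral_quotient = group G for G :: "('a, 'm) monoid_scheme" (structure) +
  fixes D :: "'a set" and \<delta> :: "'a \<Rightarrow> bool \<times> int"
  assumes hom: "\<delta> \<in> hom G dihedral" and surj: "\<delta> ` carrier G = UNIV"
    and kernel: "D = kernel G dihedral \<delta>"

sublocale dihedral_quotient \<subseteq> \<delta>: group_hom G dihedral \<delta>
  by (intro group_hom.intro group_hom_axioms.intro is_group group_dihedral hom)

context dihedral_quotient
begin

lemma mem_D_iff: "x \<in> D \<longleftrightarrow> x \<in> carrier G \<and> \<delta> x = (False, 0)"
  by (simp add: kernel kernel_def)

lemma D_subgroup: "subgroup D G"
  using \<delta>.subgroup_kernel by (simp add: kernel)

lemma ex_preimage: "\<exists>x\<in>carrier G. \<delta> x = y"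
  using surj by (metis UNIV_I imageE)

lemma D_conj: "g \<in> carrier G \<Longrightarrow> d \<in> D \<Longrightarrow> g \<otimes> d \<otimes> inv g \<in> D"
  by (cases "\<delta> g") (auto simp: mem_D_iff)

lemma translation_nat_pow:
  assumes "x \<in> carrier G" "\<delta> x = (False, n)"
  shows "\<delta> (x [^] (i::nat)) = (False, int i * n)"
  using assms by (induction i) (auto simp: algebra_simps)

lemma translation_int_pow:
  assumes "x \<in> carrier G" "\<delta> x = (False, n)"
  shows "\<delta> (x [^] (i::int)) = (False, i * n)"
  using assms by (cases i rule: int_cases2) (simp_all add: int_pow_int int_pow_neg_int translation_nat_pow)

text \<open>A reflection times its conjugate by the unit translation is the translation by
  \<open>- 2\<close>, so a normal subgroup containing a reflection also contains translations modulo
  \<open>D\<close>.\<close>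

lemma normal_subgroup_translation:
  assumes K: "subgroup K G" and normal: "\<And>g k. g \<in> carrier G \<Longrightarrow> k \<in> K \<Longrightarrow> g \<otimes> k \<otimes> inv g \<in> K"
    and "\<not> K \<subseteq> D"
  shows "\<exists>k\<in>K. \<exists>m. m \<noteq> 0 \<and> \<delta> k = (False, m)"
proof -
  obtain k where k: "k \<in> K" "k \<notin> D" using assms(3) by blast
  have kc: "k \<in> carrier G" by (rule subgroup.mem_carrier[OF K k(1)])
  obtain s m where sm: "\<delta> k = (s, m)" by force
  show ?thesis
  proof (cases s)
    case False
    then show ?thesis using k kc sm by (auto simp: mem_D_iff)
  next
    case True
    obtain g where g: "g \<in> carrier G" "\<delta> g = (False, 1)" using ex_preimage by blast
    have "\<delta> (k \<otimes> (g \<otimes> k \<otimes> inv g)) = (False, - 2)"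
      using g kc sm True by simp
    moreover have "k \<otimes> (g \<otimes> k \<otimes> inv g) \<in> K" by (rule subgroup.m_closed[OF K k(1) normal[OF g(1) k(1)]])
    ultimately show ?thesis by (intro bexI exI[of _ "- 2"]) auto
  qed
qed

lemma finite_normal_subgroup:
  assumes K: "subgroup K G" and normal: "\<And>g k. g \<in> carrier G \<Longrightarrow> k \<in> K \<Longrightarrow> g \<otimes> k \<otimes> inv g \<in> K"
    and fin: "finite (\<delta> ` K)"
  shows "K \<subseteq> D"
proof (rule ccontr)
  assume "\<not> K \<subseteq> D"
  then obtain k m where k: "k \<in> K" "m \<noteq> 0" "\<delta> k = (False, m)"
    using normal_subgroup_translation[OF K normal] by blast
  have kc: "k \<in> carrier G" by (rule subgroup.mem_carrier[OF K k(1)])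
  have "k [^] i \<in> K" for i :: nat
    using k(1) by (induction i) (auto simp: subgroup.one_closed[OF K] subgroup.m_closed[OF K])
  then have "range (\<lambda>i. \<delta> (k [^] (i::nat))) \<subseteq> \<delta> ` K" by blast
  then have "finite (range (\<lambda>i. \<delta> (k [^] (i::nat))))" by (rule finite_subset[OF _ fin])
  moreover have "inj (\<lambda>i. \<delta> (k [^] (i::nat)))"
    using k(2) by (simp add: inj_def translation_nat_pow[OF kc k(3)])
  ultimately show False using finite_imageD by blast
qed

text \<open>Reflections square into \<open>D\<close>, so they vanish in the torsion-free integers; a
  translation times a reflection is again a reflection.\<close>

lemma hom_integer_trivial:
  assumes \<tau>: "\<tau> \<in> hom G integer_group" and D: "\<And>d. d \<in> D \<Longrightarrow> \<tau> d = 0" and x: "x \<in> carrier G"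
  shows "\<tau> x = 0"
proof -
  have refl: "\<tau> y = 0" if y: "y \<in> carrier G" "fst (\<delta> y)" for y
  proof -
    have "y \<otimes> y \<in> D" using y by (cases "\<delta> y") (auto simp: mem_D_iff)
    then have "\<tau> (y \<otimes> y) = 0" by (rule D)
    then show ?thesis using hom_mult[OF \<tau> y(1) y(1)] by simp
  qed
  obtain r where r: "r \<in> carrier G" "\<delta> r = (True, 0)" using ex_preimage by blast
  show ?thesis
  proof (cases "fst (\<delta> x)")
    case False
    have "fst (\<delta> (x \<otimes> r))" using x r False by (cases "\<delta> x") auto
    then have "\<tau> (x \<otimes> r) = 0" using x r by (intro refl) auto
    then show ?thesis using hom_mult[OF \<tau> x r(1)] refl[OF r(1)] r(2) by simp
  qed (use refl x in auto)
qed

text \<open>If \<open>K\<close> were properly smaller, some \<open>d\<close> in \<open>D\<close>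
  would be a nonzero translation for \<open>\<epsilon>\<close>. Powers of \<open>d\<close> and of an
  element with nonzero \<open>\<delta>\<close>-translation can be matched modulo \<open>K\<close>,
  but \<open>\<delta>\<close> kills only the former.\<close>

lemma kernel_eq_if_subset:
  assumes K: "dihedral_quotient G K \<epsilon>" and KD: "K \<subseteq> D"
  shows "K = D"
proof (rule ccontr)
  interpret K: dihedral_quotient G K \<epsilon> by (rule K)
  assume "K \<noteq> D"
  then have "\<not> D \<subseteq> K" using KD by blast
  then obtain d m where d: "d \<in> D" "m \<noteq> 0" "\<epsilon> d = (False, m)"
    using K.normal_subgroup_translation[OF D_subgroup D_conj] by blast
  have dc: "d \<in> carrier G" by (rule subgroup.mem_carrier[OF D_subgroup d(1)])
  obtain u where u: "u \<in> carrier G" "\<delta> u = (False, 1)" using ex_preimage by blast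
  \<comment> \<open>Squaring yields a translation for \<open>\<epsilon>\<close> too, even if
    \<open>u\<close> is a reflection there.\<close>
  then have uu: "u \<otimes> u \<in> carrier G" "\<delta> (u \<otimes> u) = (False, 2)" by simp_all
  obtain q where q: "\<epsilon> (u \<otimes> u) = (False, q)"
    using u by (cases "\<epsilon> u") auto
  have "(u \<otimes> u) [^] m \<otimes> inv (d [^] q) \<in> K"
    using uu dc K.translation_int_pow[OF uu(1) q, of m] K.translation_int_pow[OF dc d(3), of q]
    by (simp add: K.mem_D_iff)
  then have "\<delta> ((u \<otimes> u) [^] m \<otimes> inv (d [^] q)) = (False, 0)" using KD mem_D_iff by blast
  moreover have "\<delta> (d [^] q) = (False, 0)"
    using translation_int_pow[OF dc, of 0 q] d(1) by (simp add: mem_D_iff)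
  ultimately show False
    using uu dc d(2) translation_int_pow[OF uu, of m] by simp
qed

text \<open>On a finite image, conjugation by \<open>inv s\<close> is injective, hence onto, so the
  image of \<open>K\<close> is normal and therefore trivial. Then \<open>\<delta> s\<close> alone
  generates the dihedral group, which is not cyclic.\<close>

lemma ascending_image_infinite:
  assumes K: "subgroup K G" and s: "s \<in> carrier G" and asc: "\<And>k. k \<in> K \<Longrightarrow> inv s \<otimes> k \<otimes> s \<in> K"
    and gen: "generate G (insert s K) = carrier G"
  shows "infinite (\<delta> ` K)"
proof
  assume fin: "finite (\<delta> ` K)"
  have Kc: "K \<subseteq> carrier G" by (rule subgroup.subset[OF K])
  have SK: "insert s K \<subseteq> carrier G" using s Kc by simp
  define c where "c y = inv\<^bsub>dihedral\<^esub> \<delta> s \<otimes>\<^bsub>dihedral\<^esub> y \<otimes>\<^bsub>dihedral\<^esub> \<delta> s" for y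
  have c: "\<delta> (inv s \<otimes> x \<otimes> s) = c (\<delta> x)" if "x \<in> carrier G" for x
    using that s by (simp add: c_def)
  have inj: "inj c" by (cases "\<delta> s") (auto simp: inj_def c_def split: if_splits)
  have "c ` \<delta> ` K \<subseteq> \<delta> ` K" using asc c Kc by (auto simp: image_iff) (metis subsetD)
  then have ci: "c ` \<delta> ` K = \<delta> ` K"
    using endo_inj_surj[OF fin _ inj_on_subset[OF inj subset_UNIV]] by blast
  \<comment> \<open>The full preimage is taken because \<open>s\<close> may fail to normalise
    \<open>K\<close> itself; it normalises only the image.\<close>
  define B where "B = {x \<in> carrier G. \<delta> x \<in> \<delta> ` K}"
  have dK: "subgroup (\<delta> ` K) dihedral" by (rule \<delta>.subgroup_img_is_subgroup[OF K])
  have B: "subgroup B G"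
  proof (rule subgroupI)
    show "B \<noteq> {}" using subgroup.one_closed[OF K] by (auto simp: B_def)
    show "inv a \<in> B" if "a \<in> B" for a
      using that subgroup.m_inv_closed[OF dK] by (simp add: B_def)
    show "a \<otimes> b \<in> B" if "a \<in> B" "b \<in> B" for a b
      using that subgroup.m_closed[OF dK] by (simp add: B_def)
  qed (auto simp: B_def)
  have KB: "K \<subseteq> B" using Kc by (auto simp: B_def)
  have Bc: "x \<in> carrier G" if "x \<in> B" for x using that by (simp add: B_def)
  have conjK: "k \<otimes> b \<otimes> inv k \<in> B" if "k \<in> B" "b \<in> B" for k b
    using that by (intro subgroup.m_closed[OF B] subgroup.m_inv_closed[OF B])
  have conj_inv: "inv s \<otimes> b \<otimes> s \<in> B" if "b \<in> B" for b
  proof -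
    have "c (\<delta> b) \<in> \<delta> ` K" using that ci by (auto simp: B_def)
    then show ?thesis using c that s by (simp add: B_def)
  qed
  have conj: "s \<otimes> b \<otimes> inv s \<in> B" if b: "b \<in> B" for b
  proof -
    have "\<delta> b \<in> c ` \<delta> ` K" using ci b by (simp add: B_def)
    then obtain k where k: "k \<in> K" "\<delta> b = c (\<delta> k)" by blast
    have kc: "k \<in> carrier G" using k Kc by blast
    have "s \<otimes> (inv s \<otimes> k \<otimes> s) \<otimes> inv s = k"
      using s kc by (simp add: m_assoc) (simp add: m_assoc[symmetric])
    then have "\<delta> s \<otimes>\<^bsub>dihedral\<^esub> c (\<delta> k) \<otimes>\<^bsub>dihedral\<^esub> inv\<^bsub>dihedral\<^esub> \<delta> s = \<delta> k"
      using s kc by (simp add: c_def flip: \<delta>.hom_mult \<delta>.hom_inv)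
    then show ?thesis using s b k Bc[OF b] by (simp add: B_def)
  qed
  have normal: "\<forall>b\<in>B. g \<otimes> b \<otimes> inv g \<in> B" if "g \<in> carrier G" for g
    using SK that[folded gen]
  proof (induction rule: generate_induct_left)
    case one
    then show ?case using Bc by simp
  next
    case (mult x y)
    have xc: "x \<in> carrier G" using mult(1) SK by blast
    have x: "x \<otimes> b \<otimes> inv x \<in> B \<and> inv x \<otimes> b \<otimes> x \<in> B" if "b \<in> B" for b
      using mult(1) conj[OF that] conj_inv[OF that] conjK[OF _ that, of x] conjK[OF _ that, of "inv x"]
        KB subgroup.m_inv_closed[OF B, of x] xc by auto
    have "(x \<otimes> y) \<otimes> b \<otimes> inv (x \<otimes> y) = x \<otimes> (y \<otimes> b \<otimes> inv y) \<otimes> inv x"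
      "(inv x \<otimes> y) \<otimes> b \<otimes> inv (inv x \<otimes> y) = inv x \<otimes> (y \<otimes> b \<otimes> inv y) \<otimes> x" if "b \<in> B" for b
      using xc mult(2) Bc[OF that] by (simp_all add: inv_mult_group m_assoc)
    then show ?case using x mult(3) by simp
  qed
  have "B \<subseteq> D"
    by (rule finite_normal_subgroup[OF B]) (use normal fin in \<open>auto simp: B_def intro: finite_subset\<close>)
  then have K1: "\<delta> k = (False, 0)" if "k \<in> K" for k using KB that mem_D_iff by blast
  \<comment> \<open>With \<open>K\<close> in the kernel, \<open>\<delta> s\<close> is central in the
    image, and the infinite dihedral group has trivial centre.\<close>
  have comm: "\<delta> g \<otimes>\<^bsub>dihedral\<^esub> \<delta> s = \<delta> s \<otimes>\<^bsub>dihedral\<^esub> \<delta> g" if "g \<in> carrier G" for g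
    using SK that[folded gen]
  proof (induction rule: generate_induct_left)
    case one
    then show ?case by (cases "\<delta> s") simp
  next
    case (mult x y)
    have xc: "x \<in> carrier G" using mult(1) SK by blast
    from mult(1) show ?case
    proof
      assume "x = s"
      then show ?thesis using mult s by (cases "\<delta> s"; cases "\<delta> y") (auto split: if_splits)
    next
      assume "x \<in> K"
      then show ?thesis using mult xc K1[of x] by (cases "\<delta> s"; cases "\<delta> y") auto
    qed
  qed
  have s1: "\<delta> s = (False, 0)"
  proof -
    obtain x y where "x \<in> carrier G" "\<delta> x = (False, 1)" "y \<in> carrier G" "\<delta> y = (True, 0)"
      using ex_preimage by metis
    then show ?thesis using comm[of x] comm[of y] by (cases "\<delta> s") (auto split: if_splits)
  qed
  have "\<delta> g = (False, 0)" if "g \<in> carrier G" for g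
    using SK that[folded gen]
  proof (induction rule: generate_induct_left)
    case (mult x y)
    then show ?case using SK K1[of x] s1 by auto
  qed simp
  then show False using ex_preimage[of "(True, 0)"] by auto
qed

end

section \<open>Alternating products and the dihedral quotient of an amalgamated product\<close>

primrec alternating :: "('a, 'm) monoid_scheme \<Rightarrow> (bool \<Rightarrow> 'a) \<Rightarrow> nat \<Rightarrow> bool \<Rightarrow> 'a" where
  "alternating G x 0 s = \<one>\<^bsub>G\<^esub>"
| "alternating G x (Suc n) s = x s \<otimes>\<^bsub>G\<^esub> alternating G x n (\<not> s)"

context group
begin

lemma amalgam_dihedral_quotient:
  assumes nt: "nontrivial_amalgamated_product G C D E"
    and free: "\<not> contains_nonabelian_free_subgroup G"
  shows "\<exists>\<delta>. dihedral_quotient G D \<delta>"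
proof -
  define P where "P s = (if s then C else E)" for s
  have am: "amalgamated_product G (P True) D (P False)" and CD: "C \<noteq> D" and ED: "D \<noteq> E"
    using nt by (auto simp: nontrivial_amalgamated_product_def P_def)
  then have sub: "subgroup C G" "subgroup E G" "subgroup D G" "D \<subseteq> C" "D \<subseteq> E"
    by (auto simp: amalgamated_product_def P_def)
  interpret amalgam G P D
    by (intro amalgam.intro amalgam_axioms.intro is_group) (use sub in \<open>auto simp: P_def\<close>)
  obtain c e where ce: "c \<in> C" "c \<notin> D" "e \<in> E" "e \<notin> D" using CD ED sub by blast
  define x where "x s = (if s then c else e)" for s
  have x: "x s \<in> P s - D" for s using ce by (simp add: x_def P_def)
  have xc: "x s \<in> carrier G" for s using x P_carrier by blast
  have inv: "inv y \<in> P s - D" if "y \<in> P s - D" for s y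
    using that subgroup.m_inv_closed[OF P, of y s] subgroup.m_inv_closed[OF D, of "inv y"] P_carrier
    by auto
  \<comment> \<open>Otherwise \<open>D\<close> and the cosets of \<open>z\<close> and
    \<open>inv y\<close> are three distinct left cosets in \<open>P s\<close>.\<close>
  have index: "y \<otimes> z \<in> D" if y: "y \<in> P s - D" and z: "z \<in> P s - D" for s y z
  proof (rule ccontr)
    have "y \<in> carrier G" using y P_carrier by blast
    moreover assume "y \<otimes> z \<notin> D"
    ultimately have "inv (inv y) \<otimes> z \<notin> D" by simp
    then show False using free_subgroup_if_index_gt_2[OF am z inv[OF y] _ x] free by blast
  qed
  have out: "y \<otimes> d \<in> P s - D" if y: "y \<in> P s - D" and d: "d \<in> D" for s y d
    using y subgroup.m_closed[OF P _ D_P[OF d]] subgroup_mult_mem_iff(2)[OF D d, of y] P_carrier by auto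
  have D_mult: "a \<otimes> b \<in> D" if "a \<in> D" "b \<in> D" for a b using that by (rule subgroup.m_closed[OF D])
  have gen: "generate G (C \<union> E) = carrier G"
  proof -
    have pres: "has_presentation G (C <+> E)
      (mult_table G C Inl \<union> mult_table G E Inr \<union> {([(Inl h, True)], [(Inr h, True)]) | h. h \<in> D})
      (case_sum (\<lambda>a. a) (\<lambda>b. b))"
      using am by (auto simp: amalgamated_product_def P_def)
    have "case_sum (\<lambda>a. a) (\<lambda>b. b) ` (C <+> E) = C \<union> E" by (force simp: Plus_def image_Un image_image)
    then show ?thesis using presentation_generate(1)[OF pres] by simp
  qed
  \<comment> \<open>With index two, any reflection may be assigned to the complement of
    \<open>D\<close>. The values 0 and 1 chosen below for the two factors give reflections that
    generate the dihedral group.\<close>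
  have hom: "(\<lambda>y. if y \<in> D then (False, 0) else (True, n)) \<in> hom (G\<lparr>carrier := P s\<rparr>) dihedral" for s n
  proof (rule homI)
    fix y z assume "y \<in> carrier (G\<lparr>carrier := P s\<rparr>)" "z \<in> carrier (G\<lparr>carrier := P s\<rparr>)"
    then have yz: "y \<in> P s" "z \<in> P s" by auto
    then have "y \<in> carrier G" "z \<in> carrier G" using P_carrier by auto
    then show "(if y \<otimes>\<^bsub>G\<lparr>carrier := P s\<rparr>\<^esub> z \<in> D then (False, 0) else (True, n)) =
        (if y \<in> D then (False, 0) else (True, n)) \<otimes>\<^bsub>dihedral\<^esub>
        (if z \<in> D then (False, 0) else (True, n))"
      using index[of y s z] yz subgroup_mult_mem_iff[OF D] by auto
  qed simp
  have "\<exists>\<delta>\<in>hom G dihedral. (\<forall>y\<in>P True. \<delta> y = (if y \<in> D then (False, 0) else (True, 0))) \<and>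
      (\<forall>y\<in>P False. \<delta> y = (if y \<in> D then (False, 0) else (True, 1)))"
    by (rule amalgamated_product_hom[OF am group_dihedral hom hom]) simp
  then obtain \<delta> where \<delta>: "\<delta> \<in> hom G dihedral"
    and \<delta>P: "\<And>s y. y \<in> P s \<Longrightarrow> \<delta> y = (if y \<in> D then (False, 0) else (True, if s then 0 else 1))"
    by (metis (full_types))
  interpret \<delta>: group_hom G dihedral \<delta>
    by (intro group_hom.intro group_hom_axioms.intro is_group group_dihedral \<delta>)
  have \<delta>D: "\<delta> d = (False, 0)" if "d \<in> D" for d using \<delta>P[OF D_P[OF that]] that by simp
  have \<delta>x: "\<delta> (x s) = (True, if s then 0 else 1)" for s using \<delta>P[of "x s" s] x by simp
  have alt_c: "alternating G x n s \<in> carrier G" for n s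
    by (induction n arbitrary: s) (auto simp: xc)
  \<comment> \<open>Each pair of factors contributes a unit translation whose direction depends on
    the first letter; only the empty product goes to the identity.\<close>
  have \<delta>alt: "\<delta> (alternating G x n s) = (odd n, if s then - int (n div 2) else int ((n + 1) div 2))" for n s
  proof (induction n arbitrary: s)
    case (Suc n)
    then show ?case by (auto simp: xc alt_c \<delta>x split: if_splits)
  qed simp
  have left: "\<exists>d\<in>D. \<exists>n r. y \<otimes> g = d \<otimes> alternating G x n r"
    if y: "y \<in> P s" and d: "d \<in> D" and g: "g = d \<otimes> alternating G x n r" for y s d g n r
  proof (cases "y \<in> D")
    case True
    then have "y \<otimes> g = (y \<otimes> d) \<otimes> alternating G x n r" using g d alt_c D_carrier by (simp add: m_assoc)
    then show ?thesis using D_mult[OF True d] by blast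
  next
    case False
    have yc: "y \<in> carrier G" and dc: "d \<in> carrier G" using y d P_carrier D_carrier by auto
    \<comment> \<open>Index two lets \<open>y d\<close> be traded for \<open>x s\<close> at the cost
      of an element of \<open>D\<close>. Then \<open>x s\<close> either lengthens the alternating
      product or merges with an equal first letter into \<open>D\<close>.\<close>
    define d' where "d' = y \<otimes> d \<otimes> inv (x s)"
    have d': "d' \<in> D" unfolding d'_def using index[OF out inv[OF x]] y False d by blast
    have d'c: "d' \<in> carrier G" by (rule D_carrier[OF d'])
    have "y \<otimes> d = d' \<otimes> x s" using yc dc xc by (simp add: d'_def m_assoc)
    then have eq: "y \<otimes> g = d' \<otimes> (x s \<otimes> alternating G x n r)"
      using yc dc xc d'c alt_c g by (simp flip: m_assoc)
    show ?thesis
    proof (cases "n > 0 \<and> r = s")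
      case True
      then obtain m where n: "n = Suc m" by (cases n) auto
      have "x s \<otimes> x s \<in> D" by (rule index[OF x x])
      moreover have "y \<otimes> g = (d' \<otimes> (x s \<otimes> x s)) \<otimes> alternating G x m (\<not> s)"
        using eq True xc d'c alt_c by (simp add: n m_assoc)
      ultimately show ?thesis using D_mult d' by blast
    next
      case False
      then have "x s \<otimes> alternating G x n r = alternating G x (Suc n) s" by (cases n) auto
      then show ?thesis using eq d' by metis
    qed
  qed
  have form: "\<exists>d\<in>D. \<exists>n r. g = d \<otimes> alternating G x n r" if "g \<in> carrier G" for g
  proof -
    have CE: "C \<union> E \<subseteq> carrier G" using sub by (auto dest: subgroup.mem_carrier)
    show ?thesis using CE that[folded gen]
    proof (induction rule: generate_induct_left)
      case one
      then show ?case using subgroup.one_closed[OF D] alternating.simps(1) l_one one_closed by metis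
    next
      case (mult y g)
      have "y \<in> P True \<or> y \<in> P False" using mult(1) by (simp add: P_def)
      then obtain s where y: "y \<in> P s" by blast
      obtain d n r where d: "d \<in> D" "g = d \<otimes> alternating G x n r" using mult(3) by blast
      show ?case using left[OF y d] left[OF subgroup.m_inv_closed[OF P y] d] by (rule conjI)
    qed
  qed
  have "D = kernel G dihedral \<delta>"
  proof
    show "D \<subseteq> kernel G dihedral \<delta>" using \<delta>D D_carrier by (auto simp: kernel_def)
    show "kernel G dihedral \<delta> \<subseteq> D"
    proof
      fix g assume "g \<in> kernel G dihedral \<delta>"
      then have g: "g \<in> carrier G" "\<delta> g = (False, 0)" by (auto simp: kernel_def)
      then obtain d n r where d: "d \<in> D" "g = d \<otimes> alternating G x n r" using form by blast
      then have "(odd n, if r then - int (n div 2) else int ((n + 1) div 2)) = (False, 0)"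
        using g \<delta>D[OF d(1)] D_carrier alt_c \<delta>alt[of n r] by simp
      then have "n = 0" by (auto split: if_splits elim!: evenE)
      then show "g \<in> D" using d D_carrier by simp
    qed
  qed
  moreover have "\<delta> ` carrier G = UNIV"
  proof -
    have trans: "\<exists>g\<in>carrier G. \<delta> g = (False, n)" for n
    proof (induction n rule: int_induct[where k = 0])
      case base
      then show ?case using \<delta>.hom_one by (intro bexI[of _ \<one>]) auto
    next
      case (step1 i)
      then obtain g where g: "g \<in> carrier G" "\<delta> g = (False, i)" by blast
      then have "\<delta> (g \<otimes> (x False \<otimes> x True)) = (False, i + 1)" using xc \<delta>x by simp
      then show ?case using g(1) xc by (meson m_closed)
    next
      case (step2 i)
      then obtain g where g: "g \<in> carrier G" "\<delta> g = (False, i)" by blast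
      then have "\<delta> (g \<otimes> (x True \<otimes> x False)) = (False, i - 1)" using xc \<delta>x by simp
      then show ?case using g(1) xc by (meson m_closed)
    qed
    have "\<exists>g\<in>carrier G. \<delta> g = (r, n)" for r n
    proof (cases r)
      case True
      obtain g where g: "g \<in> carrier G" "\<delta> g = (False, n)" using trans by blast
      then have "\<delta> (g \<otimes> x True) = (True, n)" using xc \<delta>x by simp
      then show ?thesis using True g(1) xc by (metis m_closed)
    qed (use trans in simp)
    then show ?thesis by (auto simp: image_iff) metis
  qed
  ultimately have "dihedral_quotient G D \<delta>"
    using \<delta> is_group by (simp add: dihedral_quotient_def dihedral_quotient_axioms_def)
  then show ?thesis by blast
qed

end

section \<open>Virtual containment of subgroups\<close>

text \<open>\<open>K\<close> is covered by finitely many right cosets of \<open>H\<close>; for subgroups this says that \<open>H \<inter> K\<close> has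
  finite index in \<open>K\<close>, but it is visibly transitive.\<close>

definition virtually_contained :: "('a, 'm) monoid_scheme \<Rightarrow> 'a set \<Rightarrow> 'a set \<Rightarrow> bool" where
  "virtually_contained G K H \<longleftrightarrow>
    (\<exists>F. finite F \<and> F \<subseteq> carrier G \<and> (\<forall>x\<in>K. \<exists>f\<in>F. \<exists>h\<in>H. x = h \<otimes>\<^bsub>G\<^esub> f))"

lemma virtually_containedI:
  "finite F \<Longrightarrow> F \<subseteq> carrier G \<Longrightarrow> (\<And>x. x \<in> K \<Longrightarrow> \<exists>f\<in>F. \<exists>h\<in>H. x = h \<otimes>\<^bsub>G\<^esub> f) \<Longrightarrow>
    virtually_contained G K H"
  unfolding virtually_contained_def by (intro exI[of _ F]) simp

lemma virtually_containedE:
  assumes "virtually_contained G K H"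
  obtains F where "finite F" "F \<subseteq> carrier G"
    "\<forall>x\<in>K. \<exists>f\<in>F. \<exists>h\<in>H. x = h \<otimes>\<^bsub>G\<^esub> f"
  using assms that unfolding virtually_contained_def by auto

context group
begin

lemma finite_index_iff_virtually_contained:
  assumes H: "subgroup H G" and K: "subgroup K G"
  shows "finite_index_in G (H \<inter> K) K \<longleftrightarrow> virtually_contained G K H"
proof -
  have HK: "subgroup (H \<inter> K) G" by (rule subgroups_Inter_pair[OF H K])
  have Kc: "K \<subseteq> carrier G" by (rule subgroup.subset[OF K])
  have eq: "rcosets\<^bsub>G\<lparr>carrier := K\<rparr>\<^esub> (H \<inter> K) = (\<lambda>x. (H \<inter> K) #> x) ` K"
    unfolding RCOSETS_def r_coset_def by (simp add: UNION_singleton_eq_range)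
  show ?thesis unfolding finite_index_in_def eq
  proof
    assume "finite ((\<lambda>x. (H \<inter> K) #> x) ` K)"
    from finite_subset_image[OF this subset_refl]
    obtain F where F: "F \<subseteq> K" "finite F" "(\<lambda>x. (H \<inter> K) #> x) ` K = (\<lambda>x. (H \<inter> K) #> x) ` F"
      by auto
    show "virtually_contained G K H"
    proof (rule virtually_containedI[OF F(2) subset_trans[OF F(1) Kc]])
      fix x assume x: "x \<in> K"
      then have "(H \<inter> K) #> x \<in> (\<lambda>x. (H \<inter> K) #> x) ` F" unfolding F(3)[symmetric] by (rule imageI)
      then obtain f where f: "f \<in> F" "(H \<inter> K) #> x = (H \<inter> K) #> f" by (rule imageE)
      have "x \<in> (H \<inter> K) #> x" by (rule rcos_self[OF subsetD[OF Kc x] HK])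
      then have "x \<in> (H \<inter> K) #> f" unfolding f(2) .
      then show "\<exists>f\<in>F. \<exists>h\<in>H. x = h \<otimes> f" using f(1) by (auto simp: r_coset_def)
    qed
  next
    assume "virtually_contained G K H"
    then obtain F where F: "finite F" "F \<subseteq> carrier G" "\<forall>x\<in>K. \<exists>f\<in>F. \<exists>h\<in>H. x = h \<otimes> f"
      by (rule virtually_containedE)
    \<comment> \<open>The covering elements may lie outside \<open>K\<close>; each one whose coset
      of \<open>H\<close> meets \<open>K\<close> is replaced by an element of \<open>K\<close> in
      that coset.\<close>
    have "(\<lambda>x. (H \<inter> K) #> x) ` K \<subseteq> (\<lambda>f. (H \<inter> K) #> (SOME y. y \<in> K \<and> (\<exists>h\<in>H. y = h \<otimes> f))) ` F"
    proof (rule image_subsetI)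
      fix x assume x: "x \<in> K"
      obtain f h where f: "f \<in> F" "h \<in> H" "x = h \<otimes> f" using bspec[OF F(3) x] by auto
      define y where "y = (SOME y. y \<in> K \<and> (\<exists>h\<in>H. y = h \<otimes> f))"
      have "y \<in> K \<and> (\<exists>h\<in>H. y = h \<otimes> f)"
        unfolding y_def by (rule someI[of _ x]) (use x f in auto)
      then obtain h' where h': "y \<in> K" "h' \<in> H" "y = h' \<otimes> f" by auto
      have car: "h \<in> carrier G" "h' \<in> carrier G" "f \<in> carrier G" "y \<in> carrier G"
        using subgroup.mem_carrier[OF H f(2)] subgroup.mem_carrier[OF H h'(2)] subsetD[OF F(2) f(1)]
          subsetD[OF Kc h'(1)] by auto
      have "x \<otimes> inv y = h \<otimes> inv h'"
        using car by (simp add: f h' inv_mult_group m_assoc) (simp add: m_assoc[symmetric])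
      moreover have "h \<otimes> inv h' \<in> H" by (intro subgroup.m_closed[OF H] subgroup.m_inv_closed[OF H] f h')
      moreover have "x \<otimes> inv y \<in> K" by (intro subgroup.m_closed[OF K] subgroup.m_inv_closed[OF K] x h')
      moreover have "x = (x \<otimes> inv y) \<otimes> y" using car by (simp add: f m_assoc)
      ultimately have "x \<in> (H \<inter> K) #> y" unfolding r_coset_def by auto
      then have "(H \<inter> K) #> x = (H \<inter> K) #> y" using repr_independence[OF _ car(4) HK] by simp
      then show "(H \<inter> K) #> x \<in> (\<lambda>f. (H \<inter> K) #> (SOME y. y \<in> K \<and> (\<exists>h\<in>H. y = h \<otimes> f))) ` F"
        unfolding y_def using f(1) by (intro image_eqI[of _ _ f])
    qed
    then show "finite ((\<lambda>x. (H \<inter> K) #> x) ` K)" by (rule finite_surj[OF F(1)])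
  qed
qed

lemma virtually_contained_if_subset:
  assumes "K \<subseteq> H" "H \<subseteq> carrier G"
  shows "virtually_contained G K H"
proof (rule virtually_containedI[of "{\<one>}"])
  fix x assume "x \<in> K"
  then have "x \<in> H" "x = x \<otimes> \<one>" using assms by auto
  then show "\<exists>f\<in>{\<one>}. \<exists>h\<in>H. x = h \<otimes> f" by auto
qed auto

lemma virtually_contained_trans:
  assumes KH: "virtually_contained G K H" and HL: "virtually_contained G H L"
    and L: "L \<subseteq> carrier G"
  shows "virtually_contained G K L"
proof -
  obtain F where F: "finite F" "F \<subseteq> carrier G" "\<forall>x\<in>K. \<exists>f\<in>F. \<exists>h\<in>H. x = h \<otimes> f"
    using KH by (rule virtually_containedE)
  obtain E where E: "finite E" "E \<subseteq> carrier G" "\<forall>x\<in>H. \<exists>e\<in>E. \<exists>l\<in>L. x = l \<otimes> e"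
    using HL by (rule virtually_containedE)
  show ?thesis
  proof (rule virtually_containedI[of "(\<lambda>(e, f). e \<otimes> f) ` (E \<times> F)"])
    fix x assume x: "x \<in> K"
    obtain f h where f: "f \<in> F" "h \<in> H" "x = h \<otimes> f" using bspec[OF F(3) x] by auto
    obtain e l where e: "e \<in> E" "l \<in> L" "h = l \<otimes> e" using bspec[OF E(3) f(2)] by auto
    have "l \<in> carrier G" "e \<in> carrier G" "f \<in> carrier G" using e f L E F by auto
    then have "x = l \<otimes> (e \<otimes> f)" using e f by (simp add: m_assoc)
    then show "\<exists>g\<in>(\<lambda>(e, f). e \<otimes> f) ` (E \<times> F). \<exists>h\<in>L. x = h \<otimes> g" using e(1,2) f(1) by force
  qed (use E F in auto)
qed

lemma virtually_contained_conj:
  assumes KH: "virtually_contained G K H" and g: "g \<in> carrier G" and H: "H \<subseteq> carrier G"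
  shows "virtually_contained G ((\<lambda>x. g \<otimes> x \<otimes> inv g) ` K) ((\<lambda>x. g \<otimes> x \<otimes> inv g) ` H)"
proof -
  obtain F where F: "finite F" "F \<subseteq> carrier G" "\<forall>x\<in>K. \<exists>f\<in>F. \<exists>h\<in>H. x = h \<otimes> f"
    using KH by (rule virtually_containedE)
  show ?thesis
  proof (rule virtually_containedI[of "(\<lambda>x. g \<otimes> x \<otimes> inv g) ` F"])
    fix z assume "z \<in> (\<lambda>x. g \<otimes> x \<otimes> inv g) ` K"
    then obtain x where x: "x \<in> K" "z = g \<otimes> x \<otimes> inv g" by auto
    obtain f h where f: "f \<in> F" "h \<in> H" "x = h \<otimes> f" using bspec[OF F(3) x(1)] by auto
    have car: "f \<in> carrier G" "h \<in> carrier G" using f F H by auto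
    have "z = (g \<otimes> h \<otimes> inv g) \<otimes> (g \<otimes> f \<otimes> inv g)"
      using car g by (simp add: f x m_assoc) (simp add: m_assoc[symmetric])
    then show "\<exists>f\<in>(\<lambda>x. g \<otimes> x \<otimes> inv g) ` F. \<exists>h\<in>(\<lambda>x. g \<otimes> x \<otimes> inv g) ` H. z = h \<otimes> f"
      using f by auto
  qed (use F g in auto)
qed

text \<open>A homomorphism that kills \<open>H\<close> is constant on each of the finitely many
  right cosets of \<open>H\<close>.\<close>

lemma virtually_contained_finite_image:
  assumes KH: "virtually_contained G K H" and H: "H \<subseteq> carrier G"
    and h: "h \<in> hom G M" and M: "group M" and one: "\<And>x. x \<in> H \<Longrightarrow> h x = \<one>\<^bsub>M\<^esub>"
  shows "finite (h ` K)"
proof -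
  interpret M: group M by (rule M)
  obtain F where F: "finite F" "F \<subseteq> carrier G" "\<forall>x\<in>K. \<exists>f\<in>F. \<exists>h\<in>H. x = h \<otimes> f"
    using KH by (rule virtually_containedE)
  have "h ` K \<subseteq> h ` F"
  proof (rule image_subsetI)
    fix x assume x: "x \<in> K"
    obtain f y where f: "f \<in> F" "y \<in> H" "x = y \<otimes> f" using bspec[OF F(3) x] by auto
    have "f \<in> carrier G" "y \<in> carrier G" using f F H by auto
    then have "h x = h f" using f one hom_mult[OF h, of y f] hom_in_carrier[OF h, of f] by simp
    then show "h x \<in> h ` F" using f(1) by simp
  qed
  then show ?thesis by (rule finite_surj[OF F(1)])
qed

lemma hom_integer_finite_image:
  assumes \<tau>: "\<tau> \<in> hom G integer_group" and K: "subgroup K G" and fin: "finite (\<tau> ` K)" and k: "k \<in> K"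
  shows "\<tau> k = 0"
proof (rule ccontr)
  assume nz: "\<tau> k \<noteq> 0"
  have kc: "k \<in> carrier G" by (rule subgroup.mem_carrier[OF K k])
  have pow: "k [^] i \<in> K" for i :: nat
    using k by (induction i) (auto simp: subgroup.one_closed[OF K] subgroup.m_closed[OF K])
  have "\<tau> \<one> = 0" using hom_mult[OF \<tau> one_closed one_closed] by simp
  then have \<tau>p: "\<tau> (k [^] i) = int i * \<tau> k" for i :: nat
    using kc by (induction i) (auto simp: hom_mult[OF \<tau>] algebra_simps)
  have "range (\<lambda>i::nat. \<tau> (k [^] i)) \<subseteq> \<tau> ` K" using pow by blast
  then have "finite (range (\<lambda>i::nat. \<tau> (k [^] i)))" by (rule finite_subset[OF _ fin])
  moreover have "inj (\<lambda>i::nat. \<tau> (k [^] i))" using nz by (simp add: inj_def \<tau>p)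
  ultimately show False using finite_imageD by blast
qed

end

section \<open>Ascending HNN extensions\<close>

locale ascending = group G for G :: "('a, 'm) monoid_scheme" (structure) +
  fixes K :: "'a set" and s :: 'a and \<tau> :: "'a \<Rightarrow> int"
  assumes K: "subgroup K G" and s: "s \<in> carrier G"
    and asc: "k \<in> K \<Longrightarrow> inv s \<otimes> k \<otimes> s \<in> K"
    and gen: "generate G (insert s K) = carrier G"
    and \<tau>: "\<tau> \<in> hom G integer_group" and \<tau>s: "\<tau> s = 1" and \<tau>K: "k \<in> K \<Longrightarrow> \<tau> k = 0"
begin

sublocale \<tau>: group_hom G integer_group \<tau>
  by (intro group_hom.intro group_hom_axioms.intro is_group group_integer_group \<tau>)

lemma K_carrier: "k \<in> K \<Longrightarrow> k \<in> carrier G"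
  by (rule subgroup.mem_carrier[OF K])

lemma inv_integer [simp]: "inv\<^bsub>integer_group\<^esub> n = - n"
  by (rule group.inv_equality[OF group_integer_group]) simp_all

lemma \<tau>_pow_s: "\<tau> (s [^] (i::nat)) = int i"
  by (induction i) (use s \<tau>s in auto)

lemma asc_pow: "k \<in> K \<Longrightarrow> inv (s [^] (i::nat)) \<otimes> k \<otimes> s [^] i \<in> K"
proof (induction i)
  case (Suc i)
  have "inv (s [^] Suc i) \<otimes> k \<otimes> s [^] Suc i = inv s \<otimes> (inv (s [^] i) \<otimes> k \<otimes> s [^] i) \<otimes> s"
    using s K_carrier[OF Suc.prems] by (simp add: inv_mult_group m_assoc)
  then show ?case using asc Suc by simp
qed (use K_carrier in simp)

text \<open>An element of \<open>K\<close> can be moved rightwards past \<open>s^i\<close>, becoming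
  its conjugate, which is again in \<open>K\<close>.\<close>

lemma ex_form:
  assumes "g \<in> carrier G"
  shows "\<exists>i j. \<exists>k\<in>K. g = s [^] (i::nat) \<otimes> k \<otimes> inv (s [^] (j::nat))"
proof -
  have "insert s K \<subseteq> carrier G" using s K_carrier by auto
  then show ?thesis using assms[folded gen]
  proof (induction rule: generate_induct_left)
    case one
    show ?case
      by (rule exI[of _ 0], rule exI[of _ 0], rule bexI[of _ \<one>]) (simp_all add: subgroup.one_closed[OF K])
  next
    case (mult x y)
    then obtain i j k where y: "k \<in> K" "y = s [^] (i::nat) \<otimes> k \<otimes> inv (s [^] (j::nat))" by blast
    have kc: "k \<in> carrier G" by (rule K_carrier[OF y(1)])
    have K_step: "\<exists>i j. \<exists>k\<in>K. x' \<otimes> y = s [^] (i::nat) \<otimes> k \<otimes> inv (s [^] (j::nat))" if x': "x' \<in> K" for x'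
    proof -
      have "x' \<otimes> y = s [^] i \<otimes> ((inv (s [^] i) \<otimes> x' \<otimes> s [^] i) \<otimes> k) \<otimes> inv (s [^] j)"
        using K_carrier[OF x'] kc s by (simp add: y(2) m_assoc) (simp add: m_assoc[symmetric])
      then show ?thesis using subgroup.m_closed[OF K asc_pow[OF x'] y(1)] by blast
    qed
    from mult(1) show ?case
    proof
      assume x: "x = s"
      have "s \<otimes> y = s [^] Suc i \<otimes> k \<otimes> inv (s [^] j)"
        using nat_pow_mult[OF s, of 1 i] s kc by (simp add: y(2) m_assoc) (simp add: m_assoc[symmetric])
      moreover have "\<exists>i j. \<exists>k\<in>K. inv s \<otimes> y = s [^] (i::nat) \<otimes> k \<otimes> inv (s [^] (j::nat))"
      proof (cases i)
        case 0
        \<comment> \<open>With no power of \<open>s\<close> left to cancel, \<open>inv s\<close>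
          passes through \<open>k\<close> and lengthens the power on the right.\<close>
        have "inv s \<otimes> y = s [^] (0::nat) \<otimes> (inv s \<otimes> k \<otimes> s) \<otimes> inv (s [^] Suc j)"
          using s kc nat_pow_mult[OF s, of 1 j]
          by (simp add: y(2) 0 inv_mult_group m_assoc) (simp add: m_assoc[symmetric])
        then show ?thesis using asc[OF y(1)] by blast
      next
        case (Suc i')
        have "s [^] i = s \<otimes> s [^] i'" using nat_pow_mult[OF s, of 1 i'] s Suc by simp
        then have "inv s \<otimes> y = s [^] i' \<otimes> k \<otimes> inv (s [^] j)"
          using s kc by (simp add: y(2) m_assoc) (simp add: m_assoc[symmetric])
        then show ?thesis using y(1) by blast
      qed
      ultimately show ?thesis using x y(1) by blast
    next
      assume x: "x \<in> K"
      show ?thesis using K_step[OF x] K_step[OF subgroup.m_inv_closed[OF K x]] by blast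
    qed
  qed
qed

lemma kernel_form:
  assumes g: "g \<in> carrier G" "\<tau> g = 0"
  shows "\<exists>i::nat. inv (s [^] i) \<otimes> g \<otimes> s [^] i \<in> K"
proof -
  obtain i j k where k: "k \<in> K" "g = s [^] (i::nat) \<otimes> k \<otimes> inv (s [^] (j::nat))"
    using ex_form g by blast
  have kc: "k \<in> carrier G" by (rule K_carrier[OF k(1)])
  have "i = j" using g kc s by (simp add: k(2) \<tau>_pow_s \<tau>K[OF k(1)])
  then have "inv (s [^] i) \<otimes> g \<otimes> s [^] i = k"
    using kc s by (simp add: k(2) m_assoc) (simp add: m_assoc[symmetric])
  then show ?thesis using k(1) by blast
qed

text \<open>By \<open>kernel_form\<close> the kernel of \<open>\<tau>\<close> is the union of the
  conjugates \<open>s^i K s^-i\<close>, which increase with \<open>i\<close>; finitely many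
  generators lie in a single one.\<close>

lemma finitely_generated_kernel:
  assumes A: "finitely_generated G A" and ker: "\<And>a. a \<in> A \<Longrightarrow> \<tau> a = 0"
  shows "\<exists>i::nat. \<forall>a\<in>A. inv (s [^] i) \<otimes> a \<otimes> s [^] i \<in> K"
proof -
  obtain S where S: "finite S" "S \<subseteq> carrier G" "A = generate G S"
    using A by (auto simp: finitely_generated_def)
  have mono: "inv (s [^] j) \<otimes> a \<otimes> s [^] j \<in> K"
    if "a \<in> carrier G" "inv (s [^] i) \<otimes> a \<otimes> s [^] i \<in> K" "i \<le> j" for a and i j :: nat
  proof -
    have "s [^] j = s [^] i \<otimes> s [^] (j - i)" using that s by (simp add: nat_pow_mult)
    then have "inv (s [^] j) \<otimes> a \<otimes> s [^] j =
        inv (s [^] (j - i)) \<otimes> (inv (s [^] i) \<otimes> a \<otimes> s [^] i) \<otimes> s [^] (j - i)"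
      using that s by (simp add: inv_mult_group m_assoc)
    then show ?thesis using asc_pow[OF that(2)] by simp
  qed
  have "\<forall>a\<in>S. \<exists>i::nat. inv (s [^] i) \<otimes> a \<otimes> s [^] i \<in> K"
    using S ker kernel_form by (auto intro: generate.incl)
  then obtain i where i: "\<forall>a\<in>S. inv (s [^] (i a :: nat)) \<otimes> a \<otimes> s [^] i a \<in> K"
    by metis
  define n where "n = Max (i ` S)"
  have n: "inv (s [^] n) \<otimes> a \<otimes> s [^] n \<in> K" if "a \<in> S" for a
    using mono[of a "i a" n] that S i by (auto simp: n_def)
  have "inv (s [^] n) \<otimes> a \<otimes> s [^] n \<in> K" if "a \<in> A" for a
    using S(2) that[unfolded S(3)]
  proof (induction rule: generate_induct_left)
    case one
    then show ?case using s by (simp add: subgroup.one_closed[OF K])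
  next
    case (mult x y)
    have xc: "x \<in> carrier G" using mult(1) S(2) by blast
    have "inv (s [^] n) \<otimes> (x \<otimes> y) \<otimes> s [^] n =
        (inv (s [^] n) \<otimes> x \<otimes> s [^] n) \<otimes> (inv (s [^] n) \<otimes> y \<otimes> s [^] n)"
      "inv (s [^] n) \<otimes> (inv x \<otimes> y) \<otimes> s [^] n =
        inv (inv (s [^] n) \<otimes> x \<otimes> s [^] n) \<otimes> (inv (s [^] n) \<otimes> y \<otimes> s [^] n)"
      using xc mult(2) s by (simp_all add: inv_mult_group m_assoc) (simp_all add: m_assoc[symmetric])
    then show ?case
      using n[OF mult(1)] mult(3) subgroup.m_closed[OF K] subgroup.m_inv_closed[OF K] by simp
  qed
  then show ?thesis by blast
qed

text \<open>The property passes to products of elements \<open>g\<close>, as virtual containment is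
  transitive and survives conjugation. Elements of \<open>K\<close> preserve \<open>K\<close>,
  \<open>s\<close> enlarges it, and \<open>base\<close> is the case of \<open>inv s\<close>.\<close>

lemma commensurated:
  assumes base: "virtually_contained G K ((\<lambda>x. inv s \<otimes> x \<otimes> s) ` K)" and g: "g \<in> carrier G"
  shows "virtually_contained G K ((\<lambda>x. g \<otimes> x \<otimes> inv g) ` K)"
proof -
  have Kc: "K \<subseteq> carrier G" using K_carrier by blast
  have image_carrier: "(\<lambda>x. g \<otimes> x \<otimes> inv g) ` K \<subseteq> carrier G" if "g \<in> carrier G" for g
    using that Kc by auto
  have step: "virtually_contained G K ((\<lambda>x. (u \<otimes> v) \<otimes> x \<otimes> inv (u \<otimes> v)) ` K)"
    if "u \<in> carrier G" "v \<in> carrier G" "virtually_contained G K ((\<lambda>x. u \<otimes> x \<otimes> inv u) ` K)"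
      "virtually_contained G K ((\<lambda>x. v \<otimes> x \<otimes> inv v) ` K)" for u v
  proof -
    have "(\<lambda>x. u \<otimes> x \<otimes> inv u) ` (\<lambda>x. v \<otimes> x \<otimes> inv v) ` K = (\<lambda>x. (u \<otimes> v) \<otimes> x \<otimes> inv (u \<otimes> v)) ` K"
      unfolding image_image using that Kc by (intro image_cong) (auto simp: inv_mult_group m_assoc)
    then show ?thesis
      using virtually_contained_trans[OF that(3) virtually_contained_conj[OF that(4,1)]] image_carrier that
      by simp
  qed
  have gens: "virtually_contained G K ((\<lambda>x. u \<otimes> x \<otimes> inv u) ` K)" if u: "u \<in> K" for u
  proof (rule virtually_contained_if_subset)
    show "K \<subseteq> (\<lambda>x. u \<otimes> x \<otimes> inv u) ` K"
    proof
      fix x assume x: "x \<in> K"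
      have "x = u \<otimes> (inv u \<otimes> x \<otimes> u) \<otimes> inv u"
        using K_carrier[OF u] K_carrier[OF x] by (simp add: m_assoc) (simp add: m_assoc[symmetric])
      then show "x \<in> (\<lambda>x. u \<otimes> x \<otimes> inv u) ` K"
        using u x by (blast intro: subgroup.m_closed[OF K] subgroup.m_inv_closed[OF K])
    qed
  qed (use u K_carrier image_carrier in auto)
  have gs: "virtually_contained G K ((\<lambda>x. s \<otimes> x \<otimes> inv s) ` K)"
  proof (rule virtually_contained_if_subset)
    show "K \<subseteq> (\<lambda>x. s \<otimes> x \<otimes> inv s) ` K"
    proof
      fix x assume x: "x \<in> K"
      have "x = s \<otimes> (inv s \<otimes> x \<otimes> s) \<otimes> inv s"
        using s K_carrier[OF x] by (simp add: m_assoc) (simp add: m_assoc[symmetric])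
      then show "x \<in> (\<lambda>x. s \<otimes> x \<otimes> inv s) ` K" using asc[OF x] by blast
    qed
  qed (use s image_carrier in auto)
  have "insert s K \<subseteq> carrier G" using s Kc by simp
  then show ?thesis using g[folded gen]
  proof (induction rule: generate_induct_left)
    case one
    have "(\<lambda>x. \<one> \<otimes> x \<otimes> inv \<one>) ` K = K" using Kc by (force simp: image_def)
    then show ?case using virtually_contained_if_subset[OF subset_refl Kc] by simp
  next
    case (mult x y)
    have "virtually_contained G K ((\<lambda>z. x \<otimes> z \<otimes> inv x) ` K) \<and>
      virtually_contained G K ((\<lambda>z. inv x \<otimes> z \<otimes> inv (inv x)) ` K)"
      using mult(1) gens gs base s subgroup.m_inv_closed[OF K] by auto
    then show ?case using step[of x y] step[of "inv x" y] mult s K_carrier by auto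
  qed
qed

end

section \<open>Ascending structures from HNN extensions, and transport of presentations\<close>

context group
begin

text \<open>The base retained is the splitting subgroup \<open>K\<close>, not \<open>B\<close>. If
  \<open>\<theta>\<close> maps onto \<open>B\<close>, then \<open>t\<close> conjugates
  \<open>B\<close>, and with it \<open>K\<close>, into \<open>K\<close>; the stable letter becomes
  \<open>inv t\<close> and the homomorphism changes sign. The last clause keeps the given
  \<open>t\<close> when the extension is ascending as it stands.\<close>

lemma hnn_extension_imp_ascending:
  assumes hnn: "hnn_extension G B K \<theta> t" and free: "\<not> contains_nonabelian_free_subgroup G"
  shows "\<exists>s \<tau>. ascending G K s \<tau> \<and> (K = B \<longrightarrow> s = t)"
proof -
  note h = hnn_extension_props[OF hnn]
  have "\<exists>\<tau>\<in>hom G integer_group. \<tau> t = 1 \<and> (\<forall>x\<in>B. \<tau> x = 0)"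
    by (rule hnn_extension_hom[OF hnn group_integer_group]) (auto simp: hom_def)
  then obtain \<tau> where \<tau>: "\<tau> \<in> hom G integer_group" "\<tau> t = 1" "\<And>x. x \<in> B \<Longrightarrow> \<tau> x = 0" by blast
  interpret \<tau>: group_hom G integer_group \<tau>
    by (intro group_hom.intro group_hom_axioms.intro is_group group_integer_group \<tau>(1))
  show ?thesis
  proof (cases "K = B")
    case True
    have "inv t \<otimes> k \<otimes> t \<in> K" if "k \<in> K" for k
      using h(5,8) that True by (auto simp: hom_def)
    then have "ascending G K t \<tau>"
      using h \<tau> True by (simp add: ascending_def ascending_axioms_def is_group)
    then show ?thesis by blast
  next
    case False
    then have \<theta>: "\<theta> ` K = B" using hnn_extension_ascending[OF hnn free] by blast
    have Kc: "K \<subseteq> carrier G" by (rule subgroup.subset[OF h(2)])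
    have conj: "t \<otimes> b \<otimes> inv t \<in> K" if "b \<in> B" for b
    proof -
      obtain k where k: "k \<in> K" "b = inv t \<otimes> k \<otimes> t" using \<theta> h(8) \<open>b \<in> B\<close> by fastforce
      then have "t \<otimes> b \<otimes> inv t = k"
        using h(4) Kc by (simp add: m_assoc subsetD) (simp add: m_assoc[symmetric] subsetD)
      then show ?thesis using k by simp
    qed
    have sub: "insert (inv t) K \<subseteq> carrier G" using h(4) Kc by simp
    have gsub: "subgroup (generate G (insert (inv t) K)) G" by (rule generate_is_subgroup[OF sub])
    have t: "inv t \<in> generate G (insert (inv t) K)" by (rule generate.incl) simp
    then have t': "t \<in> generate G (insert (inv t) K)"
      using subgroup.m_inv_closed[OF gsub t] h(4) by simp
    have "B \<subseteq> generate G (insert (inv t) K)"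
    proof
      fix b assume "b \<in> B"
      then obtain k where k: "k \<in> K" "b = inv t \<otimes> k \<otimes> t" using \<theta> h(8) by fastforce
      then show "b \<in> generate G (insert (inv t) K)"
        using t t' by (auto intro: generate.eng generate.incl)
    qed
    then have "generate G (insert t B) \<subseteq> generate G (insert (inv t) K)"
      using t' generate_subgroup_incl[OF _ gsub] by simp
    then have gen: "generate G (insert (inv t) K) = carrier G"
      using h(7) generate_incl[OF sub] by blast
    have "(\<lambda>x. - \<tau> x) \<in> hom G integer_group"
      using \<tau>.hom_mult by (auto simp: hom_def)
    moreover have "inv\<^bsub>integer_group\<^esub> (1::int) = - 1"
      by (rule group.inv_equality[OF group_integer_group]) simp_all
    then have "\<tau> (inv t) = - 1" using \<tau>(2) h(4) by simp
    ultimately have "ascending G K (inv t) (\<lambda>x. - \<tau> x)"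
      using h gen \<tau> conj by (auto simp: ascending_def ascending_axioms_def is_group)
    then show ?thesis using False by blast
  qed
qed

text \<open>Equality of values is pulled back along the injective \<open>\<alpha>\<close> to a
  congruence of the old words, which renaming by \<open>f\<close> pushes forward to the new
  ones.\<close>

lemma has_presentation_transfer:
  assumes pres: "has_presentation G X R g" and R: "R \<subseteq> words_over X \<times> words_over X"
    and \<alpha>: "\<alpha> \<in> iso G G" and g': "\<And>x. x \<in> X \<Longrightarrow> g' (f x) = \<alpha> (g x)"
  shows "has_presentation G (f ` X) (map_prod (map (apfst f)) (map (apfst f)) ` R) g'"
proof -
  let ?m = "map (apfst f)"
  let ?R = "map_prod ?m ?m ` R"
  interpret \<alpha>: group_hom G G \<alpha>
    using \<alpha> by (intro group_hom.intro group_hom_axioms.intro is_group) (simp add: iso_def)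
  have inj: "inj_on \<alpha> (carrier G)" and surj: "\<alpha> ` carrier G = carrier G"
    using \<alpha> by (auto simp: iso_def bij_betw_def)
  have g: "g \<in> X \<rightarrow> carrier G" and gen: "generate G (g ` X) = carrier G"
    and eq: "\<And>u v. u \<in> words_over X \<Longrightarrow> v \<in> words_over X \<Longrightarrow>
      word_val G g u = word_val G g v \<longleftrightarrow> (u, v) \<in> word_cong X R"
    using pres by (auto simp: has_presentation_iff)
  have g'c: "g' \<in> f ` X \<rightarrow> carrier G" using g g' by (auto simp: Pi_iff)
  have m: "?m w \<in> words_over (f ` X)" if "w \<in> words_over X" for w
    using that by (induction w) auto
  have m_ex: "\<exists>w\<in>words_over X. w' = ?m w" if "w' \<in> words_over (f ` X)" for w'
    using that
  proof (induction w')
    case Nil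
    then show ?case by (intro bexI[of _ "[]"]) auto
  next
    case (Cons l w')
    then obtain w x where w: "w \<in> words_over X" "w' = ?m w" "x \<in> X" "fst l = f x" by auto
    then show ?case by (intro bexI[of _ "(x, snd l) # w"]) (auto simp: prod_eq_iff)
  qed
  have val: "word_val G g' (?m w) = \<alpha> (word_val G g w)" if "w \<in> words_over X" for w
    using that
  proof (induction w)
    case (Cons l w)
    then have "letter_val G g' (apfst f l) = \<alpha> (letter_val G g l)"
      using g g' by (auto simp: letter_val_def Pi_iff)
    moreover have "letter_val G g l \<in> carrier G" "word_val G g w \<in> carrier G"
      using Cons.prems letter_val_closed[OF g, of l] word_val_closed[OF g, of w] by auto
    ultimately show ?case using Cons by simp
  qed simp
  have cong: "(?m u, ?m v) \<in> word_cong (f ` X) ?R" if "(u, v) \<in> word_cong X R" for u v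
    using that
  proof induction
    case (cancel x b)
    then show ?case using word_cong.cancel[of "f x" "f ` X" b ?R] by simp
  next
    case (relator u v)
    then show ?case by (intro word_cong.relator m) (auto intro: rev_image_eqI)
  next
    case (append u v u' v')
    then show ?case by (simp add: word_cong.append)
  qed (auto intro: word_cong.refl m word_cong.sym word_cong.trans)
  have "word_val G g' u' = word_val G g' v' \<longleftrightarrow> (u', v') \<in> word_cong (f ` X) ?R"
    if uv': "u' \<in> words_over (f ` X)" "v' \<in> words_over (f ` X)" for u' v'
  proof
    assume "word_val G g' u' = word_val G g' v'"
    moreover obtain u v where uv: "u \<in> words_over X" "u' = ?m u" "v \<in> words_over X" "v' = ?m v"
      using m_ex uv' by meson
    ultimately have "\<alpha> (word_val G g u) = \<alpha> (word_val G g v)" using val by simp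
    then have "word_val G g u = word_val G g v"
      using inj_onD[OF inj] word_val_closed[OF g] uv by blast
    then show "(u', v') \<in> word_cong (f ` X) ?R" using eq cong uv by blast
  next
    assume uv: "(u', v') \<in> word_cong (f ` X) ?R"
    show "word_val G g' u' = word_val G g' v'"
    proof (rule word_cong_word_val[OF g'c _ uv])
      fix u' v' assume "(u', v') \<in> ?R"
      then obtain u v where uv: "(u, v) \<in> R" "u' = ?m u" "v' = ?m v" by auto
      then show "word_val G g' u' = word_val G g' v'"
        using R eq[of u v] word_cong.relator[of u v R X] val by auto
    qed
  qed
  moreover have "generate G (g' ` f ` X) = carrier G"
  proof
    show "generate G (g' ` f ` X) \<subseteq> carrier G" using g'c by (intro generate_incl) auto
    show "carrier G \<subseteq> generate G (g' ` f ` X)"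
    proof
      fix y assume "y \<in> carrier G"
      then obtain x where x: "x \<in> carrier G" "y = \<alpha> x" using surj by blast
      then obtain w where w: "w \<in> words_over X" "word_val G g w = x"
        using generate_imp_word_val[OF g] gen by blast
      then show "y \<in> generate G (g' ` f ` X)"
        using word_val_generate[OF g'c m[OF w(1)]] val x by simp
    qed
  qed
  ultimately show ?thesis using g'c by (simp add: has_presentation_iff)
qed

text \<open>Conjugation by \<open>t\<close> carries the given presentation to one with base \<open>\<phi> ` A\<close>.\<close>

lemma ascending_hnn_extension_image:
  assumes hnn: "ascending_hnn_extension G A \<phi> t"
  shows "ascending_hnn_extension G (\<phi> ` A) \<phi> t"
proof -
  note h = hnn_extension_props[OF hnn]
  have \<phi>A: "\<phi> a \<in> A" if "a \<in> A" for a using h(5) that by (auto simp: hom_def)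
  have Ac: "a \<in> carrier G" if "a \<in> A" for a by (rule subgroup.mem_carrier[OF h(1) that])
  have \<phi>_mult: "\<phi> (a \<otimes> b) = \<phi> a \<otimes> \<phi> b" if "a \<in> A" "b \<in> A" for a b
    using h(5) that by (auto simp: hom_def)
  let ?X = "insert None (Some ` A)"
  let ?R = "mult_table G A Some \<union>
        {([(None, False), (Some h, True), (None, True)], [(Some (\<phi> h), True)]) | h. h \<in> A}"
  let ?f = "map_option \<phi>"
  \<comment> \<open>Conjugation restricts to \<open>\<phi>\<close> on \<open>A\<close> and fixes
    \<open>t\<close>, so on generators it is the renaming \<open>map_option \<phi>\<close>.\<close>
  define \<alpha> where "\<alpha> x = inv t \<otimes> x \<otimes> t" for x
  have pres: "has_presentation G ?X ?R (case_option t (\<lambda>a. a))"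
    using hnn by (simp add: hnn_extension_def)
  have R: "?R \<subseteq> words_over ?X \<times> words_over ?X"
    using \<phi>A by (auto simp: mult_table_def subgroup.m_closed[OF h(1)])
  have "\<alpha> \<in> hom G G"
  proof (rule homI)
    fix x y assume "x \<in> carrier G" "y \<in> carrier G"
    then show "\<alpha> (x \<otimes> y) = \<alpha> x \<otimes> \<alpha> y"
      using h(4) by (simp add: \<alpha>_def m_assoc) (simp add: m_assoc[symmetric])
  qed (use h(4) in \<open>simp add: \<alpha>_def\<close>)
  moreover have "bij_betw \<alpha> (carrier G) (carrier G)"
    by (rule bij_betwI[where g = "\<lambda>x. t \<otimes> x \<otimes> inv t"])
      (use h(4) in \<open>auto simp: \<alpha>_def m_assoc\<close>, simp_all add: m_assoc[symmetric])
  ultimately have \<alpha>: "\<alpha> \<in> iso G G" by (simp add: iso_def)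
  have g': "case_option t (\<lambda>a. a) (?f x) = \<alpha> (case_option t (\<lambda>a. a) x)" if "x \<in> ?X" for x
    using that h(4,8) by (auto simp: \<alpha>_def)
  have X': "?f ` ?X = insert None (Some ` \<phi> ` A)" by (auto simp: image_image)
  have "map_prod (map (apfst ?f)) (map (apfst ?f)) ` ?R = mult_table G (\<phi> ` A) Some \<union>
        {([(None, False), (Some h, True), (None, True)], [(Some (\<phi> h), True)]) | h. h \<in> \<phi> ` A}"
    (is "?l = ?r")
  proof
    show "?l \<subseteq> ?r" by (auto simp: mult_table_def \<phi>_mult)
    show "?r \<subseteq> ?l"
    proof
      fix p assume "p \<in> ?r"
      then consider a b where "a \<in> A" "b \<in> A"
          "p = ([(Some (\<phi> a), True), (Some (\<phi> b), True)], [(Some (\<phi> a \<otimes> \<phi> b), True)])"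
        | a where "a \<in> A"
          "p = ([(None, False), (Some (\<phi> a), True), (None, True)], [(Some (\<phi> (\<phi> a)), True)])"
        unfolding mult_table_def by blast
      then show "p \<in> ?l"
      proof cases
        case 1
        then have "([(Some a, True), (Some b, True)], [(Some (a \<otimes> b), True)]) \<in> ?R"
          unfolding mult_table_def by blast
        then show ?thesis using 1 \<phi>_mult by (intro rev_image_eqI) auto
      next
        case 2
        then have "([(None, False), (Some a, True), (None, True)], [(Some (\<phi> a), True)]) \<in> ?R" by blast
        then show ?thesis using 2 by (intro rev_image_eqI) auto
      qed
    qed
  qed
  then have "has_presentation G (insert None (Some ` \<phi> ` A)) (mult_table G (\<phi> ` A) Some \<union>
        {([(None, False), (Some h, True), (None, True)], [(Some (\<phi> h), True)]) | h. h \<in> \<phi> ` A})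
      (case_option t (\<lambda>a. a))"
    using has_presentation_transfer[OF pres R \<alpha>, of "case_option t (\<lambda>a. a)" ?f] g' by (simp only: X')
  moreover have "subgroup (\<phi> ` A) G"
  proof -
    interpret A: group "G\<lparr>carrier := A\<rparr>" by (rule subgroup_imp_group[OF h(1)])
    interpret group_hom "G\<lparr>carrier := A\<rparr>" "G\<lparr>carrier := A\<rparr>" \<phi>
      using h(5) by unfold_locales
    show ?thesis using img_is_subgroup incl_subgroup[OF h(1)] by simp
  qed
  moreover have "\<phi> \<in> mon (G\<lparr>carrier := \<phi> ` A\<rparr>) (G\<lparr>carrier := \<phi> ` A\<rparr>)"
    using h(5,6) \<phi>A by (auto simp: mon_def hom_def inj_on_def)
  ultimately show ?thesis using h(4) by (simp add: hnn_extension_def)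
qed

end

section \<open>Comparing splittings\<close>

context dihedral_quotient
begin

lemma ascending_not_virtually_contained:
  assumes "ascending G K s \<tau>"
  shows "\<not> virtually_contained G K D"
proof
  interpret K: ascending G K s \<tau> by (rule assms)
  assume "virtually_contained G K D"
  then have "finite (\<delta> ` K)"
    using virtually_contained_finite_image[OF _ subgroup.subset[OF D_subgroup] hom group_dihedral]
    by (simp add: mem_D_iff)
  then show False using ascending_image_infinite[OF K.K K.s K.asc K.gen] by blast
qed

text \<open>Otherwise \<open>\<tau>\<close> kills \<open>D\<close> and hence factors through the
  infinite dihedral group, contradicting \<open>\<tau> s = 1\<close>.\<close>

lemma not_virtually_contained_ascending:
  assumes "ascending G K s \<tau>"
  shows "\<not> virtually_contained G D K"
proof
  interpret K: ascending G K s \<tau> by (rule assms)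
  assume "virtually_contained G D K"
  then have fin: "finite (\<tau> ` D)"
    using virtually_contained_finite_image[OF _ subgroup.subset[OF K.K] K.\<tau> group_integer_group] K.\<tau>K
    by simp
  have "\<tau> s = 0"
    using hom_integer_trivial[OF K.\<tau> hom_integer_finite_image[OF K.\<tau> D_subgroup fin] K.s] by blast
  then show False using K.\<tau>s by simp
qed

text \<open>Normality of \<open>K\<close> turns its finite image into a trivial one; what remains is
  an inclusion of kernels.\<close>

lemma eq_if_virtually_contained:
  assumes "dihedral_quotient G K \<epsilon>" "virtually_contained G K D"
  shows "K = D"
proof -
  interpret K: dihedral_quotient G K \<epsilon> by (rule assms(1))
  have "finite (\<delta> ` K)"
    using virtually_contained_finite_image[OF assms(2) subgroup.subset[OF D_subgroup] hom group_dihedral]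
    by (simp add: mem_D_iff)
  then have "K \<subseteq> D" using finite_normal_subgroup[OF K.D_subgroup K.D_conj] by blast
  then show ?thesis by (rule kernel_eq_if_subset[OF assms(1)])
qed

end

lemma (in ascending) virtually_contained_sym:
  assumes base: "virtually_contained G K ((\<lambda>x. inv s \<otimes> x \<otimes> s) ` K)" and fg: "finitely_generated G K"
    and L: "ascending G L u \<sigma>" and LK: "virtually_contained G L K"
  shows "virtually_contained G K L"
proof -
  interpret L: ascending G L u \<sigma> by (rule L)
  have fin: "finite (\<tau> ` L)"
    using virtually_contained_finite_image[OF LK subgroup.subset[OF K] \<tau> group_integer_group] \<tau>K
    by simp
  have \<tau>L: "\<tau> l = 0" if "l \<in> L" for l by (rule hom_integer_finite_image[OF \<tau> L.K fin that])
  \<comment> \<open>Both sides are homomorphisms that agree on \<open>u\<close> and vanish on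
    \<open>L\<close>. Since \<open>\<tau> s = 1\<close>, the factor \<open>\<tau> u\<close> is
    nonzero, so \<open>\<sigma>\<close> vanishes wherever \<open>\<tau>\<close> does.\<close>
  have \<tau>\<sigma>: "\<tau> g = \<sigma> g * \<tau> u" if g: "g \<in> carrier G" for g
  proof -
    have "insert u L \<subseteq> carrier G" using L.s L.K_carrier by auto
    then show ?thesis using g[folded L.gen]
    proof (induction rule: generate_induct_left)
      case (mult x y)
      have "x \<in> carrier G" "\<tau> x = \<sigma> x * \<tau> u"
        using mult(1) L.s L.K_carrier L.\<tau>s L.\<tau>K \<tau>L by auto
      then show ?case using mult(2,3) by (simp add: algebra_simps)
    qed simp
  qed
  have "\<tau> u \<noteq> 0" using \<tau>\<sigma>[OF s] \<tau>s by auto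
  then have "\<sigma> k = 0" if "k \<in> K" for k using \<tau>\<sigma>[OF K_carrier[OF that]] \<tau>K[OF that] by simp
  then obtain i :: nat where i: "\<forall>k\<in>K. inv (u [^] i) \<otimes> k \<otimes> u [^] i \<in> L"
    using L.finitely_generated_kernel[OF fg] by blast
  \<comment> \<open>Only a conjugate of \<open>K\<close> is known to lie in \<open>L\<close>;
    commensuration passes from \<open>K\<close> to that conjugate.\<close>
  have "virtually_contained G K ((\<lambda>x. inv (u [^] i) \<otimes> x \<otimes> u [^] i) ` K)"
    using commensurated[OF base, of "inv (u [^] i)"] L.s by simp
  moreover have "virtually_contained G ((\<lambda>x. inv (u [^] i) \<otimes> x \<otimes> u [^] i) ` K) L"
    by (rule virtually_contained_if_subset) (use i L.s L.K_carrier in auto)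
  ultimately show ?thesis
    by (rule virtually_contained_trans) (use L.K_carrier in blast)
qed

section \<open>The three assertions\<close>

theorem theorem41:
  fixes G :: "('a, 'm) monoid_scheme"
    and A C D E H K L :: "'a set"
    and \<phi> :: "'a \<Rightarrow> 'a" and t :: 'a
  assumes "group G"
    and "finitely_generated G (carrier G)"
    and "\<not> contains_nonabelian_free_subgroup G"
    and "ascending_hnn_extension G A \<phi> t"
    and "nontrivial_amalgamated_product G C D E"
    and "nontrivial_amalgamated_product G H K L"
    and "\<forall>P \<in> {A, C, D, E, H, K, L}. finitely_generated G P"
  shows "(\<not> finite_index_in G (D \<inter> A) A \<and> \<not> finite_index_in G (D \<inter> A) D \<and>
          \<not> smaller_subgroup G A D \<and> \<not> smaller_subgroup G D A) \<and>
         ((finite_index_in G (D \<inter> K) K \<longrightarrow> K = D) \<and>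
          \<not> smaller_subgroup G D K \<and> \<not> smaller_subgroup G K D) \<and>
         (minimal_splitting_subgroup G D \<and>
          (minimal_splitting_subgroup G A \<longleftrightarrow> finite_index_in G (\<phi> ` A) A))"
proof -
  interpret group G by (rule assms(1))
  note free = assms(3) and hnn = assms(4)
  obtain \<delta> where D: "dihedral_quotient G D \<delta>"
    using amalgam_dihedral_quotient[OF assms(5) free] by blast
  obtain \<epsilon> where K: "dihedral_quotient G K \<epsilon>"
    using amalgam_dihedral_quotient[OF assms(6) free] by blast
  obtain \<tau> where A: "ascending G A t \<tau>"
    using hnn_extension_imp_ascending[OF hnn free] by blast
  interpret D: dihedral_quotient G D \<delta> by (rule D)
  interpret K: dihedral_quotient G K \<epsilon> by (rule K)
  interpret A: ascending G A t \<tau> by (rule A)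
  have fi: "finite_index_in G (Q \<inter> P) P \<longleftrightarrow> virtually_contained G P Q"
    "finite_index_in G (P \<inter> Q) P \<longleftrightarrow> virtually_contained G P Q"
    if "subgroup P G" "subgroup Q G" for P Q
    using finite_index_iff_virtually_contained[OF that(2,1)] by (simp_all add: Int_commute)
  \<comment> \<open>For subgroups, being smaller is the strict part of the preorder
    \<open>virtually_contained\<close>.\<close>
  have smaller: "smaller_subgroup G P Q \<longleftrightarrow> virtually_contained G P Q \<and> \<not> virtually_contained G Q P"
    if "subgroup P G" "subgroup Q G" for P Q
    using fi(2)[OF that] fi(1)[OF that(2,1)] by (simp add: smaller_subgroup_def)
  have refl: "virtually_contained G P P" if "subgroup P G" for P
    by (rule virtually_contained_if_subset[OF subset_refl subgroup.subset[OF that]])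
  have AD: "\<not> virtually_contained G A D" and DA: "\<not> virtually_contained G D A"
    by (rule D.ascending_not_virtually_contained[OF A] D.not_virtually_contained_ascending[OF A])+
  have KD: "virtually_contained G K D \<Longrightarrow> K = D" by (rule D.eq_if_virtually_contained[OF K])
  have DK: "virtually_contained G D K \<Longrightarrow> D = K" by (rule K.eq_if_virtually_contained[OF D])
  \<comment> \<open>Every competitor for minimality is of one of these two types, each excluded by a
    comparison lemma.\<close>
  have cases: "(\<exists>s \<tau>. ascending G P s \<tau>) \<or> (\<exists>\<delta>. dihedral_quotient G P \<delta>)" if "splits_over G P" for P
    using that hnn_extension_imp_ascending[OF _ free] amalgam_dihedral_quotient[OF _ free]
    unfolding splits_over_def by blast
  have splits_sub: "subgroup P G" if "splits_over G P" for P
    using cases[OF that] by (auto dest: ascending.K dihedral_quotient.D_subgroup)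
  have 1: "\<not> finite_index_in G (D \<inter> A) A \<and> \<not> finite_index_in G (D \<inter> A) D \<and>
      \<not> smaller_subgroup G A D \<and> \<not> smaller_subgroup G D A"
    using AD DA fi[OF A.K D.D_subgroup] fi[OF D.D_subgroup A.K]
      smaller[OF A.K D.D_subgroup] smaller[OF D.D_subgroup A.K] by blast
  have 2: "(finite_index_in G (D \<inter> K) K \<longrightarrow> K = D) \<and>
      \<not> smaller_subgroup G D K \<and> \<not> smaller_subgroup G K D"
    using KD DK fi[OF K.D_subgroup D.D_subgroup] refl[OF D.D_subgroup]
      smaller[OF K.D_subgroup D.D_subgroup] smaller[OF D.D_subgroup K.D_subgroup] by blast
  have 3: "minimal_splitting_subgroup G D"
  proof -
    have "\<not> smaller_subgroup G P D" if P: "splits_over G P" for P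
    proof
      assume "smaller_subgroup G P D"
      then have v: "virtually_contained G P D" "\<not> virtually_contained G D P"
        using smaller[OF splits_sub[OF P] D.D_subgroup] by auto
      from cases[OF P] show False
      proof (elim disjE exE)
        fix s \<tau> assume "ascending G P s \<tau>"
        then show False using D.ascending_not_virtually_contained v(1) by blast
      next
        fix \<delta>' assume "dihedral_quotient G P \<delta>'"
        then have "P = D" using D.eq_if_virtually_contained v(1) by blast
        then show False using refl[OF D.D_subgroup] v(2) by blast
      qed
    qed
    then show ?thesis using assms(5) unfolding minimal_splitting_subgroup_def splits_over_def by blast
  qed
  note h = hnn_extension_props[OF hnn]
  \<comment> \<open>Written as a conjugate, the image of \<open>\<phi>\<close> fits the hypothesis
    \<open>base\<close> of \<open>virtually_contained_sym\<close>.\<close>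
  have \<phi>A: "\<phi> ` A = (\<lambda>x. inv\<^bsub>G\<^esub> t \<otimes>\<^bsub>G\<^esub> x \<otimes>\<^bsub>G\<^esub> t) ` A"
    using h(8) by (intro image_cong) auto
  have \<phi>A_sub: "\<phi> ` A \<subseteq> A" using h(5) by (auto simp: hom_def)
  have hnn': "ascending_hnn_extension G (\<phi> ` A) \<phi> t" by (rule ascending_hnn_extension_image[OF hnn])
  have sub': "subgroup (\<phi> ` A) G" using hnn_extension_props(1)[OF hnn'] .
  have fiA: "finite_index_in G (\<phi> ` A) A \<longleftrightarrow> virtually_contained G A (\<phi> ` A)"
    using fi(1)[OF A.K sub'] \<phi>A_sub by (simp add: Int_absorb2)
  have "minimal_splitting_subgroup G A \<longleftrightarrow> virtually_contained G A (\<phi> ` A)"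
  proof
    assume "minimal_splitting_subgroup G A"
    moreover have "splits_over G (\<phi> ` A)" using hnn' unfolding splits_over_def by blast
    ultimately have "\<not> smaller_subgroup G (\<phi> ` A) A" unfolding minimal_splitting_subgroup_def by blast
    then show "virtually_contained G A (\<phi> ` A)"
      using smaller[OF sub' A.K] virtually_contained_if_subset[OF \<phi>A_sub subgroup.subset[OF A.K]] by blast
  next
    assume v: "virtually_contained G A (\<phi> ` A)"
    have "\<not> smaller_subgroup G P A" if P: "splits_over G P" for P
    proof
      assume "smaller_subgroup G P A"
      then have w: "virtually_contained G P A" "\<not> virtually_contained G A P"
        using smaller[OF splits_sub[OF P] A.K] by auto
      from cases[OF P] show False
      proof (elim disjE exE)
        fix s \<sigma> assume "ascending G P s \<sigma>"
        then show False
          using A.virtually_contained_sym[of P s \<sigma>] v w assms(7) unfolding \<phi>A by simp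
      next
        fix \<delta>' assume "dihedral_quotient G P \<delta>'"
        then show False
          using dihedral_quotient.not_virtually_contained_ascending[OF _ A] w(1) by blast
      qed
    qed
    then show "minimal_splitting_subgroup G A"
      using hnn unfolding minimal_splitting_subgroup_def splits_over_def by blast
  qed
  then show ?thesis using 1 2 3 fiA by blast
qed

end
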